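(* Let $(V,* )$ be a magmatic algebra over a field $\mathbb{K}$ and let $(L,\{-,-\},\star)$ be a post-Lie algebra over $\mathbb{K}$. Let $\phi:(V,* )\longrightarrow(L,\star)$ be a morphism of magmatic algebras. Then there exists a unique morphism of post-Lie algebras $\overline{\phi}:(\mathcal{L}ie(V),[-,-],* )\longrightarrow (L,\{-,-\},\star)$ extending $\phi$.
   Context: A magmatic algebra is a vector space with a bilinear product (no axiom). A (right) post-Lie algebra is a triple $(\mathfrak{g},\{-,-\},* )$ where $(\mathfrak{g},\{-,-\})$ is a Lie algebra and $*$ is a bilinear product on $\mathfrak{g}$ such that for all $x,y,z\in\mathfrak{g}$: $x*\{y,z\}=(x*y)*z-x*(y*z)-(x*z)*y+x*(z*y)$ and $\{x,y\}*z=\{x*z,y\}+\{x,y*z\}$. Morphisms of post-Lie algebras are linear maps compatible with the bracket and with the second product. $T(V)$ is the tensor algebra with concatenation product (written by juxtaposition), unit $1$, deshuffling coproduct $\Delta_{sh}$ (the algebra morphism with $\Delta_{sh}(x)=x\otimes 1+1\otimes x$ for $x\in V$; Sweedler notation $\Delta_{sh}(h)=\sum h^{(1)}\otimes h^{(2)}$) and counit $\varepsilon$. The product $*$ of $V$ extends uniquely to a bilinear map $T(V)\otimes T(V)\to T(V)$ such that for all $f,g,h\in T(V)$, $x,y\in V$: $f*1=f$; $1*f=\varepsilon(f)1$; $x*(fy)=(x*f)*y-x*(f*y)$; $(fg)*h=\sum (f*h^{(1)})(g*h^{(2)})$. $\mathcal{L}ie(V)$ is the Lie subalgebra of $T(V)$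 generated by $V$ for $[f,g]=fg-gf$ (the free Lie algebra on $V$); it is stable under $*$, and $(\mathcal{L}ie(V),[-,-],* )$ is a post-Lie algebra. *)

theory Defs
  imports Complex_Main "HOL-Algebra.QuotRing" "HOL-Algebra.Module" "HOL-Library.Poly_Mapping" "HOL-Library.FuncSet"
begin

text \<open>
  The given vector spaces are types with an explicit scalar multiplication (locale
  \<open>vector_space\<close>). The tensor algebra and its tensor square are quotients depending on that scalar
  multiplication, so they are records with a carrier; as a \<open>\<K>\<close>-algebra is a ring together with a
  scalar multiplication, the record type \<open>module\<close> of HOL-Algebra is used for associative algebras.
\<close>

definition bilinear_product :: "('k::field \<Rightarrow> 'v::ab_group_add \<Rightarrow> 'v) \<Rightarrow> ('v \<Rightarrow> 'v \<Rightarrow> 'v) \<Rightarrow> bool"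
  where "bilinear_product s m \<longleftrightarrow>
    (\<forall>x. Vector_Spaces.linear s s (\<lambda>y. m x y)) \<and> (\<forall>y. Vector_Spaces.linear s s (\<lambda>x. m x y))"

locale magmatic_algebra = vector_space scale
  for scale :: "'k::field \<Rightarrow> 'v::ab_group_add \<Rightarrow> 'v"
    and prod :: "'v \<Rightarrow> 'v \<Rightarrow> 'v" +
  assumes bilinear_prod: "bilinear_product scale prod"

locale magmatic_morphism =
  dom: magmatic_algebra scaleV prodV + cod: magmatic_algebra scaleW prodW +
  Vector_Spaces.linear scaleV scaleW f
  for scaleV :: "'k::field \<Rightarrow> 'v::ab_group_add \<Rightarrow> 'v" and prodV :: "'v \<Rightarrow> 'v \<Rightarrow> 'v"
    and scaleW :: "'k \<Rightarrow> 'w::ab_group_add \<Rightarrow> 'w" and prodW :: "'w \<Rightarrow> 'w \<Rightarrow> 'w"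
    and f :: "'v \<Rightarrow> 'w" +
  assumes map_prod: "f (prodV x y) = prodW (f x) (f y)"

text \<open>The bracket is alternating, not merely antisymmetric: this matters in characteristic two.\<close>

locale lie_algebra = vector_space scale
  for scale :: "'k::field \<Rightarrow> 'l::ab_group_add \<Rightarrow> 'l"
    and br :: "'l \<Rightarrow> 'l \<Rightarrow> 'l" +
  assumes bilinear_br: "bilinear_product scale br"
    and alternating: "br x x = 0"
    and jacobi: "br x (br y z) + br y (br z x) + br z (br x y) = 0"

locale post_lie_algebra = lie_algebra scale br + magmatic_algebra scale star
  for scale :: "'k::field \<Rightarrow> 'l::ab_group_add \<Rightarrow> 'l"
    and br :: "'l \<Rightarrow> 'l \<Rightarrow> 'l" and star :: "'l \<Rightarrow> 'l \<Rightarrow> 'l" +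
  assumes star_br:
      "star x (br y z) = star (star x y) z - star x (star y z) - star (star x z) y + star x (star z y)"
    and br_star: "star (br x y) z = br (star x z) y + br x (star y z)"

text \<open>Morphisms whose source is given by a carrier and whose target is a type.\<close>

definition post_lie_morphism ::
  "('k::field, 'g) module \<Rightarrow> ('g \<Rightarrow> 'g \<Rightarrow> 'g) \<Rightarrow> ('g \<Rightarrow> 'g \<Rightarrow> 'g) \<Rightarrow>
   ('k \<Rightarrow> 'l::ab_group_add \<Rightarrow> 'l) \<Rightarrow> ('l \<Rightarrow> 'l \<Rightarrow> 'l) \<Rightarrow> ('l \<Rightarrow> 'l \<Rightarrow> 'l) \<Rightarrow> ('g \<Rightarrow> 'l) \<Rightarrow> bool"
  where "post_lie_morphism G brG starG scale br star F \<longleftrightarrow>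
    (\<forall>x\<in>carrier G. \<forall>y\<in>carrier G. F (x \<oplus>\<^bsub>G\<^esub> y) = F x + F y) \<and>
    (\<forall>c. \<forall>x\<in>carrier G. F (c \<odot>\<^bsub>G\<^esub> x) = scale c (F x)) \<and>
    (\<forall>x\<in>carrier G. \<forall>y\<in>carrier G. F (brG x y) = br (F x) (F y)) \<and>
    (\<forall>x\<in>carrier G. \<forall>y\<in>carrier G. F (starG x y) = star (F x) (F y))"

definition monoid_algebra :: "('a, 'm) monoid_scheme \<Rightarrow> ('k::field, 'a \<Rightarrow>\<^sub>0 'k) module"
  where "monoid_algebra M =
    \<lparr>carrier = {p. Poly_Mapping.keys p \<subseteq> carrier M},
     monoid.mult = (\<lambda>p q. \<Sum>a\<in>Poly_Mapping.keys p. \<Sum>b\<in>Poly_Mapping.keys q.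
       Poly_Mapping.single (a \<otimes>\<^bsub>M\<^esub> b) (Poly_Mapping.lookup p a * Poly_Mapping.lookup q b)),
     monoid.one = Poly_Mapping.single \<one>\<^bsub>M\<^esub> 1,
     ring.zero = 0,
     ring.add = (+),
     smult = (\<lambda>c. Poly_Mapping.map ((*) c))\<rparr>"

definition quotient_algebra :: "('k, 'a) module \<Rightarrow> 'a set \<Rightarrow> ('k, 'a set) module"
  where "quotient_algebra A I =
    \<lparr>carrier = carrier (A Quot I),
     monoid.mult = monoid.mult (A Quot I),
     monoid.one = monoid.one (A Quot I),
     ring.zero = ring.zero (A Quot I),
     ring.add = ring.add (A Quot I),
     smult = (\<lambda>c X. \<Union>x\<in>X. I +>\<^bsub>A\<^esub> (c \<odot>\<^bsub>A\<^esub> x))\<rparr>"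

definition algebra_hom :: "('k, 'a) module \<Rightarrow> ('k, 'b) module \<Rightarrow> ('a \<Rightarrow> 'b) set"
  where "algebra_hom A B =
    {h \<in> ring_hom A B. \<forall>c. \<forall>x\<in>carrier A. h (c \<odot>\<^bsub>A\<^esub> x) = c \<odot>\<^bsub>B\<^esub> h x}"

definition base_field :: "('k::field, 'k) module"
  where "base_field =
    \<lparr>carrier = UNIV, monoid.mult = (*), monoid.one = 1, ring.zero = 0, ring.add = (+), smult = (*)\<rparr>"

text \<open>
  \<open>T(V)\<close> is the free unital algebra on the set \<open>V\<close> (words are lists of vectors), modulo the two-sided
  ideal which makes the inclusion of \<open>V\<close> linear.
\<close>

definition free_algebra :: "('k::field, 'v list \<Rightarrow>\<^sub>0 'k) module"
  where "free_algebra = monoid_algebra \<lparr>carrier = UNIV, monoid.mult = (@), monoid.one = []\<rparr>"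

definition linearity_ideal :: "('k::field \<Rightarrow> 'v::ab_group_add \<Rightarrow> 'v) \<Rightarrow> ('v list \<Rightarrow>\<^sub>0 'k) set"
  where "linearity_ideal s = genideal free_algebra
    ({Poly_Mapping.single [x + y] 1 - Poly_Mapping.single [x] 1 - Poly_Mapping.single [y] 1 | x y. True} \<union>
     {Poly_Mapping.single [s c x] 1 - Poly_Mapping.single [x] c | c x. True})"

definition tensor_algebra ::
  "('k::field \<Rightarrow> 'v::ab_group_add \<Rightarrow> 'v) \<Rightarrow> ('k, ('v list \<Rightarrow>\<^sub>0 'k) set) module"
  where "tensor_algebra s = quotient_algebra free_algebra (linearity_ideal s)"

text \<open>The canonical embedding of \<open>V\<close> into \<open>T(V)\<close>.\<close>

definition incl :: "('k::field \<Rightarrow> 'v::ab_group_add \<Rightarrow> 'v) \<Rightarrow> 'v \<Rightarrow> ('v list \<Rightarrow>\<^sub>0 'k) set"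
  where "incl s x = linearity_ideal s +>\<^bsub>free_algebra\<^esub> Poly_Mapping.single [x] 1"

text \<open>
  \<open>A \<otimes> B\<close> is the vector space freely spanned by the pairs \<open>(a, b)\<close>, modulo the span of the bilinearity
  relations. With the product \<open>(a, b) (a', b') = (a a', b b')\<close> that span is a two-sided ideal, as the
  relations are stable under multiplication by pairs; hence it is the ideal they generate.
\<close>

definition bilinearity_ideal ::
  "('k::field, 'a) module \<Rightarrow> ('k, 'b) module \<Rightarrow> ('a \<times> 'b \<Rightarrow>\<^sub>0 'k) set"
  where "bilinearity_ideal A B = genideal (monoid_algebra (A \<times>\<times> B))
    ({Poly_Mapping.single (a \<oplus>\<^bsub>A\<^esub> a', b) 1 - Poly_Mapping.single (a, b) 1 - Poly_Mapping.single (a', b) 1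
        | a a' b. a \<in> carrier A \<and> a' \<in> carrier A \<and> b \<in> carrier B} \<union>
     {Poly_Mapping.single (a, b \<oplus>\<^bsub>B\<^esub> b') 1 - Poly_Mapping.single (a, b) 1 - Poly_Mapping.single (a, b') 1
        | a b b'. a \<in> carrier A \<and> b \<in> carrier B \<and> b' \<in> carrier B} \<union>
     {Poly_Mapping.single (c \<odot>\<^bsub>A\<^esub> a, b) 1 - Poly_Mapping.single (a, b) c
        | c a b. a \<in> carrier A \<and> b \<in> carrier B} \<union>
     {Poly_Mapping.single (a, c \<odot>\<^bsub>B\<^esub> b) 1 - Poly_Mapping.single (a, b) c
        | c a b. a \<in> carrier A \<and> b \<in> carrier B})"

definition tensor_product ::
  "('k::field, 'a) module \<Rightarrow> ('k, 'b) module \<Rightarrow> ('k, ('a \<times> 'b \<Rightarrow>\<^sub>0 'k) set) module"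
  where "tensor_product A B = quotient_algebra (monoid_algebra (A \<times>\<times> B)) (bilinearity_ideal A B)"

definition pure_tensor ::
  "('k::field, 'a) module \<Rightarrow> ('k, 'b) module \<Rightarrow> 'a \<Rightarrow> 'b \<Rightarrow> ('a \<times> 'b \<Rightarrow>\<^sub>0 'k) set"
  where "pure_tensor A B a b =
    bilinearity_ideal A B +>\<^bsub>monoid_algebra (A \<times>\<times> B)\<^esub> Poly_Mapping.single (a, b) 1"

definition deshuffle ::
  "('k::field \<Rightarrow> 'v::ab_group_add \<Rightarrow> 'v) \<Rightarrow>
   ('v list \<Rightarrow>\<^sub>0 'k) set \<Rightarrow> (('v list \<Rightarrow>\<^sub>0 'k) set \<times> ('v list \<Rightarrow>\<^sub>0 'k) set \<Rightarrow>\<^sub>0 'k) set"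
  where "deshuffle s = (let T = tensor_algebra s; TT = tensor_product T T in
    THE D. D \<in> extensional (carrier T) \<and> D \<in> algebra_hom T TT \<and>
      (\<forall>x. D (incl s x) =
        pure_tensor T T (incl s x) \<one>\<^bsub>T\<^esub> \<oplus>\<^bsub>TT\<^esub> pure_tensor T T \<one>\<^bsub>T\<^esub> (incl s x)))"

text \<open>The counit of the deshuffling coproduct is the algebra morphism vanishing on \<open>V\<close>.\<close>

definition counit :: "('k::field \<Rightarrow> 'v::ab_group_add \<Rightarrow> 'v) \<Rightarrow> ('v list \<Rightarrow>\<^sub>0 'k) set \<Rightarrow> 'k"
  where "counit s = (let T = tensor_algebra s in
    THE e. e \<in> extensional (carrier T) \<and> e \<in> algebra_hom T base_field \<and> (\<forall>x. e (incl s x) = 0))"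

definition bilinear_on :: "('k, 'a) module \<Rightarrow> ('a \<Rightarrow> 'a \<Rightarrow> 'a) \<Rightarrow> bool"
  where "bilinear_on A m \<longleftrightarrow>
    (\<forall>f\<in>carrier A. \<forall>g\<in>carrier A. m f g \<in> carrier A) \<and>
    (\<forall>f\<in>carrier A. \<forall>g\<in>carrier A. \<forall>h\<in>carrier A.
      m (f \<oplus>\<^bsub>A\<^esub> g) h = m f h \<oplus>\<^bsub>A\<^esub> m g h \<and> m f (g \<oplus>\<^bsub>A\<^esub> h) = m f g \<oplus>\<^bsub>A\<^esub> m f h) \<and>
    (\<forall>c. \<forall>f\<in>carrier A. \<forall>g\<in>carrier A.
      m (c \<odot>\<^bsub>A\<^esub> f) g = c \<odot>\<^bsub>A\<^esub> m f g \<and> m f (c \<odot>\<^bsub>A\<^esub> g) = c \<odot>\<^bsub>A\<^esub> m f g)"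

text \<open>
  \<open>m\<close> is the extension to \<open>T(V)\<close> of the product \<open>ast\<close> of \<open>V\<close>. An element of \<open>T(V) \<otimes> T(V)\<close> is the set of
  all formal sums of pairs representing it, so the last clause is the Sweedler formula
  \<open>(f g) * h = \<Sum> (f * h\<^sup>1) (g * h\<^sup>2)\<close> for an arbitrary representation of the coproduct of \<open>h\<close>.
\<close>

definition extended_product ::
  "('k::field \<Rightarrow> 'v::ab_group_add \<Rightarrow> 'v) \<Rightarrow> ('v \<Rightarrow> 'v \<Rightarrow> 'v) \<Rightarrow>
   (('v list \<Rightarrow>\<^sub>0 'k) set \<Rightarrow> ('v list \<Rightarrow>\<^sub>0 'k) set \<Rightarrow> ('v list \<Rightarrow>\<^sub>0 'k) set) \<Rightarrow> bool"
  where "extended_product s ast m \<longleftrightarrow> (let T = tensor_algebra s in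
    bilinear_on T m \<and>
    (\<forall>x y. m (incl s x) (incl s y) = incl s (ast x y)) \<and>
    (\<forall>f\<in>carrier T. m f \<one>\<^bsub>T\<^esub> = f) \<and>
    (\<forall>f\<in>carrier T. m \<one>\<^bsub>T\<^esub> f = counit s f \<odot>\<^bsub>T\<^esub> \<one>\<^bsub>T\<^esub>) \<and>
    (\<forall>x y. \<forall>f\<in>carrier T.
      m (incl s x) (f \<otimes>\<^bsub>T\<^esub> incl s y) =
        m (m (incl s x) f) (incl s y) \<ominus>\<^bsub>T\<^esub> m (incl s x) (m f (incl s y))) \<and>
    (\<forall>f\<in>carrier T. \<forall>g\<in>carrier T. \<forall>h\<in>carrier T. \<forall>p\<in>deshuffle s h.
      m (f \<otimes>\<^bsub>T\<^esub> g) h =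
        finsum T (\<lambda>(a, b). Poly_Mapping.lookup p (a, b) \<odot>\<^bsub>T\<^esub> (m f a \<otimes>\<^bsub>T\<^esub> m g b))
          (Poly_Mapping.keys p)))"

definition commutator :: "('k, 'a) module \<Rightarrow> 'a \<Rightarrow> 'a \<Rightarrow> 'a"
  where "commutator A f g = f \<otimes>\<^bsub>A\<^esub> g \<ominus>\<^bsub>A\<^esub> g \<otimes>\<^bsub>A\<^esub> f"

definition lie_subalgebra :: "('k, 'a) module \<Rightarrow> 'a set \<Rightarrow> bool"
  where "lie_subalgebra A W \<longleftrightarrow>
    W \<subseteq> carrier A \<and> \<zero>\<^bsub>A\<^esub> \<in> W \<and>
    (\<forall>f\<in>W. \<forall>g\<in>W. f \<oplus>\<^bsub>A\<^esub> g \<in> W) \<and> (\<forall>c. \<forall>f\<in>W. c \<odot>\<^bsub>A\<^esub> f \<in> W) \<and>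
    (\<forall>f\<in>W. \<forall>g\<in>W. commutator A f g \<in> W)"

definition free_lie :: "('k::field \<Rightarrow> 'v::ab_group_add \<Rightarrow> 'v) \<Rightarrow> ('k, ('v list \<Rightarrow>\<^sub>0 'k) set) module"
  where "free_lie s = (tensor_algebra s)
    \<lparr>carrier := \<Inter>{W. lie_subalgebra (tensor_algebra s) W \<and> range (incl s) \<subseteq> W}\<rparr>"

end

theory Submission
  imports Defs
begin

text \<open>
  Existence rests on two facts. First, a Lie algebra \<open>L\<close> over a field embeds into its enveloping algebra:
  rewriting words to sorted words yields multilinear functionals \<open>\<sigma>\<close> on words over \<open>L\<close>, with values in \<open>L\<close>,
  which vanish on the relations \<open>x y - y x = {x, y}\<close> and are the identity on words of length one. They show
  that the linear map \<open>V \<rightarrow> L\<close> extends to a Lie morphism \<open>F\<close> on the Lie subalgebra of \<open>T(V)\<close> generated by \<open>V\<close>.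

  Secondly, primitive elements \<open>h\<close> act on \<open>T(V)\<close> by derivations \<open>f \<mapsto> f * h\<close>, so \<open>F (f * h) = F f \<star> F h\<close> has to
  be checked for \<open>f = x \<in> V\<close> only. This goes by induction on the left-normed bracket \<open>h\<close>, together with
  \<open>x * (k h) = (x * k) * h - x * (k * h)\<close> for all \<open>k \<in> T(V)\<close>; the latter makes \<open>x * [g, y]\<close> satisfy the
  post-Lie identity.
\<close>

subsection \<open>A projection of the enveloping algebra onto the Lie algebra\<close>

text \<open>A Lie element has many expressions by brackets, so \<open>F\<close> cannot be defined by
  recursion on one of them. Products of elements of L are therefore computed in an associative
  envelope, and the obstacle is the way back to L. The envelope is not formed as a quotient; it is
  represented by \<open>\<sigma>\<close>, the projection onto words of length one along the sorted
  basis words of all other lengths. Sorting, unlike symmetrizing, involves no division by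
  factorials, so every characteristic is covered. Swapping two letters costs a word that is one
  letter shorter, hence \<open>\<sigma>\<close> is built length by length.

  For the second product, the axiom on x * (f y) speaks only of a letter y on the right, while
  [g, y] = g y - y g also has g there. The same rule with g in place of y thus has to be proved in
  the same induction as the claim on \<open>F\<close>. What closes the induction is that x * h stays
  in V for x in V and h a Lie element: the values to be compared are then values of
  \<open>\<phi>\<close>.\<close>

lemma (in lie_algebra) linear_br:
  "Vector_Spaces.linear scale scale (br x)" "Vector_Spaces.linear scale scale (\<lambda>x. br x y)"
  using bilinear_br unfolding bilinear_product_def by auto

lemma (in lie_algebra) br_simps:
  "br (x + y) z = br x z + br y z" "br x (y + z) = br x y + br x z"
  "br (scale c x) y = scale c (br x y)" "br x (scale c y) = scale c (br x y)"
  "br 0 x = 0" "br x 0 = 0" "br (- x) y = - br x y" "br x (- y) = - br x y"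
proof -
  interpret l: Vector_Spaces.linear scale scale "br w" for w by (rule linear_br)
  interpret r: Vector_Spaces.linear scale scale "\<lambda>x. br x w" for w by (rule linear_br)
  show "br (x + y) z = br x z + br y z" "br x (y + z) = br x y + br x z"
    "br (scale c x) y = scale c (br x y)" "br x (scale c y) = scale c (br x y)"
    "br 0 x = 0" "br x 0 = 0" "br (- x) y = - br x y" "br x (- y) = - br x y"
    by (simp_all add: l.add r.add l.scale r.scale l.zero r.zero l.neg r.neg)
qed

lemma (in lie_algebra) br_antisym: "br y x = - br x y"
proof -
  have "br x y + br y x = br (x + y) (x + y)"
    by (simp only: br_simps) (simp add: alternating)
  then have "br x y + br y x = 0" by (simp add: alternating)
  then show ?thesis by (metis add.inverse_unique)
qed

text \<open>The order lives on all of L and not only on \<open>B\<close>: straightening then makes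
  sense for every word, and the basis enters only when its result is made multilinear.\<close>

locale based_lie_algebra = lie_algebra scale br
  for scale :: "'k::field \<Rightarrow> 'l::ab_group_add \<Rightarrow> 'l" and br :: "'l \<Rightarrow> 'l \<Rightarrow> 'l" +
  fixes B :: "'l set" and prec :: "'l \<Rightarrow> 'l \<Rightarrow> bool" (infix "\<prec>" 50)
  assumes independent_B: "independent B" and span_B: "span B = UNIV"
    and prec_irrefl: "\<not> x \<prec> x"
    and prec_trans: "x \<prec> y \<Longrightarrow> y \<prec> z \<Longrightarrow> x \<prec> z"
    and prec_total: "x \<noteq> y \<Longrightarrow> x \<prec> y \<or> y \<prec> x"
begin

sublocale endo: vector_space_pair scale scale ..

text \<open>Each letter in turn is expanded in the basis, so only the values of \<open>s\<close> on
  words over \<open>B\<close> matter. It will be applied to \<open>straighten\<close>, which depends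
  on the order of the letters and is not multilinear itself.\<close>

primrec multilinear_extension :: "('l list \<Rightarrow> 'l) \<Rightarrow> 'l list \<Rightarrow> 'l" where
  "multilinear_extension s [] = s []"
| "multilinear_extension s (l # ls) =
    endo.construct B (\<lambda>b. multilinear_extension (\<lambda>w. s (b # w)) ls) l"

definition slotwise_linear :: "('l list \<Rightarrow> 'l) \<Rightarrow> bool" where
  "slotwise_linear G \<longleftrightarrow> (\<forall>u v. Vector_Spaces.linear scale scale (\<lambda>x. G (u @ x # v)))"

lemma slotwise_linear_multilinear_extension: "slotwise_linear (multilinear_extension s)"
proof -
  have "Vector_Spaces.linear scale scale (\<lambda>x. multilinear_extension s (u @ x # v))" for u v
  proof (induction u arbitrary: s)
    case Nil
    show ?case by (simp add: endo.linear_construct[OF independent_B])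
  next
    case (Cons a u)
    let ?g = "\<lambda>x b. multilinear_extension (\<lambda>w. s (b # w)) (u @ x # v)"
    have "?g (x + y) = (\<lambda>b. ?g x b + ?g y b)" "?g (scale c x) = (\<lambda>b. scale c (?g x b))" for x y c
      using Cons.IH by (auto simp: Vector_Spaces.linear_iff)
    then show ?case
      by (auto simp: Vector_Spaces.linear_iff vector_space_axioms endo.construct_add[OF independent_B] endo.construct_scale[OF independent_B])
  qed
  then show ?thesis by (simp add: slotwise_linear_def)
qed

lemma multilinear_extension_basis: "set w \<subseteq> B \<Longrightarrow> multilinear_extension s w = s w"
  by (induction w arbitrary: s) (simp_all add: endo.construct_basis[OF independent_B])

text \<open>Letters are released from the basis one at a time: the prefix \<open>u\<close> is
  arbitrary, the suffix \<open>v\<close> still lies over \<open>B\<close>, and linearity in the last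
  letter of the prefix trades that letter for a basis element.\<close>

lemma slotwise_linear_eq_0:
  assumes "slotwise_linear G" and "\<And>w. set w \<subseteq> B \<Longrightarrow> G w = 0"
  shows "G w = 0"
proof -
  have "G (u @ v) = 0" if "set v \<subseteq> B" for u v
    using that
  proof (induction u arbitrary: v rule: rev_induct)
    case Nil
    then show ?case using assms by simp
  next
    case (snoc x u)
    have "Vector_Spaces.linear scale scale (\<lambda>x. G (u @ x # v))"
      using assms by (simp add: slotwise_linear_def)
    then have "G (u @ x # v) = 0"
      by (rule endo.linear_eq_0_on_span[of _ B]) (use snoc in \<open>auto simp: span_B\<close>)
    then show ?case by simp
  qed
  from this[of "[]" w] show ?thesis by simp
qed

section \<open>Straightening of words and its confluence\<close>

fun inversions :: "'l list \<Rightarrow> nat" where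
  "inversions [] = 0"
| "inversions (x # w) = length (filter (\<lambda>y. y \<prec> x) w) + inversions w"

text \<open>Only the swapped pair changes its relative order. This measure serves both the
  termination of \<open>straighten\<close> and the induction behind its confluence.\<close>

lemma inversions_swap:
  assumes "y \<prec> x"
  shows "inversions (u @ y # x # v) < inversions (u @ x # y # v)"
proof -
  have "\<not> x \<prec> y" using assms prec_irrefl prec_trans by blast
  then show ?thesis using assms by (induction u) auto
qed

fun descent :: "'l list \<Rightarrow> 'l list \<times> 'l \<times> 'l \<times> 'l list \<Rightarrow> bool" where
  "descent w (u, x, y, v) \<longleftrightarrow> w = u @ x # y # v \<and> y \<prec> x"

text \<open>Rewrites x y as y x + [x, y] at a descent. The bracket term is one letter shorter and is
  evaluated by \<open>t\<close>, already built for shorter words, so only the swapped word recurs.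
  Words without descent get 0, since a sorted word of length at least two has no part of length one.
  That the choice made by \<open>SOME\<close> is immaterial is shown in
  \<open>straighten_descent\<close>.\<close>

function straighten :: "('l list \<Rightarrow> 'l) \<Rightarrow> 'l list \<Rightarrow> 'l" where
  "straighten t w = (if \<exists>d. descent w d
     then (case SOME d. descent w d of
       (u, x, y, v) \<Rightarrow> straighten t (u @ y # x # v) + t (u @ br x y # v))
     else 0)"
  by pat_completeness auto
termination
proof (relation "Wellfounded.measure (\<lambda>(t, w). inversions w)", goal_cases)
  case (2 t w u p x q y v)
  then have "descent w (u, x, y, v)" by (metis someI_ex)
  then show ?case using inversions_swap by simp
qed simp

declare straighten.simps[simp del]

text \<open>The relation x y - y x = [x, y] of the enveloping algebra, split by length:
  \<open>t\<close> is meant for words of one letter more than \<open>t'\<close>.\<close>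

definition bracket_relation :: "('l list \<Rightarrow> 'l) \<Rightarrow> ('l list \<Rightarrow> 'l) \<Rightarrow> bool" where
  "bracket_relation t t' \<longleftrightarrow>
    (\<forall>u x y v. t (u @ x # y # v) - t (u @ y # x # v) = t' (u @ br x y # v))"

text \<open>The critical pairs of the rewriting: two adjacent pairs in one word coincide, share a
  letter (either one first), or are disjoint (either one first).\<close>

lemma two_descents:
  assumes "u @ x # y # v = u' @ x' # y' # v'"
  obtains "u = u'" "x = x'" "y = y'" "v = v'"
  | "u' = u @ [x]" "x' = y" "v = y' # v'"
  | "u = u' @ [x']" "x = y'" "v' = y # v"
  | b where "u' = u @ x # y # b" "v = b @ x' # y' # v'"
  | b where "u = u' @ x' # y' # b" "v' = b @ x # y # v"
proof -
  consider (a) e where "u = u' @ e" "e @ x # y # v = x' # y' # v'"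
    | (b) e where "u' = u @ e" "e @ x' # y' # v' = x # y # v"
    using assms by (auto simp: append_eq_append_conv2)
  then show thesis
  proof cases
    case a
    then show thesis using that
      by (cases e; cases "tl e") auto
  next
    case b
    then show thesis using that
      by (cases e; cases "tl e") auto
  qed
qed

text \<open>The diamond lemma: two disjoint descents are resolved by the bracket relation one level below,
  two overlapping ones in addition by the Jacobi identity.\<close>

lemma straighten_descent:
  assumes lin: "slotwise_linear t" and lin': "slotwise_linear t'" and rel: "bracket_relation t t'"
    and "y \<prec> x"
  shows "straighten t (u @ x # y # v) = straighten t (u @ y # x # v) + t (u @ br x y # v)"
proof -
  let ?c = "\<lambda>(u, x, y, v). straighten t (u @ y # x # v) + t (u @ br x y # v)"
  have rel': "t (u @ x # y # v) = t (u @ y # x # v) + t' (u @ br x y # v)" for u x y v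
    using rel unfolding bracket_relation_def by (metis add.commute diff_eq_eq)
  have "straighten t w = ?c d" if "descent w d" for w d
    using that
  proof (induction w arbitrary: d rule: measure_induct_rule[where f = inversions])
    case (less w)
    have IH: "straighten t (u @ x # y # v) = straighten t (u @ y # x # v) + t (u @ br x y # v)"
      if "y \<prec> x" "inversions (u @ x # y # v) < inversions w" for u x y v
      using less.IH[of "u @ x # y # v" "(u, x, y, v)"] that by simp
    \<comment> \<open>Both reductions of x y z end in the sorted z y x. They differ by exchanging
      each inner bracket with the remaining letter; \<open>rel'\<close> turns these exchanges into
      values of \<open>t'\<close> on double brackets, whose sum vanishes by Jacobi.\<close>
    have overlap: "?c (u, x, y, z # v) = ?c (u @ [x], y, z, v)"
      if w: "w = u @ x # y # z # v" and yx: "y \<prec> x" and zy: "z \<prec> y" for u x y z v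
    proof -
      have zx: "z \<prec> x" using yx zy prec_trans by blast
      have i: "inversions (u @ y # x # z # v) < inversions w"
        "inversions (u @ x # z # y # v) < inversions w"
        using w inversions_swap[OF yx, of u "z # v"] inversions_swap[OF zy, of "u @ [x]" v] by auto
      then have i': "inversions (u @ y # z # x # v) < inversions w"
        "inversions (u @ z # x # y # v) < inversions w"
        using inversions_swap[OF zx, of "u @ [y]" v] inversions_swap[OF zx, of u "y # v"] by auto
      have "?c (u, x, y, z # v) = straighten t (u @ z # y # x # v) + t (u @ br y z # x # v)
          + t (u @ y # br x z # v) + t (u @ br x y # z # v)"
        using IH[of z x "u @ [y]" v] IH[of z y u "x # v"] i i' zx zy by simp
      moreover have "?c (u @ [x], y, z, v) = straighten t (u @ z # y # x # v) + t (u @ z # br x y # v)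
          + t (u @ br x z # y # v) + t (u @ x # br y z # v)"
        using IH[of z x u "y # v"] IH[of y x "u @ [z]" v] i i' zx yx by simp
      moreover have "t' (u @ br (br y z) x # v) + t' (u @ br y (br x z) # v)
          + t' (u @ br (br x y) z # v) = 0"
      proof -
        interpret l: Vector_Spaces.linear scale scale "\<lambda>x. t' (u @ x # v)"
          using lin' by (simp add: slotwise_linear_def)
        have "br (br y z) x + br y (br x z) + br (br x y) z = 0"
          using jacobi[of x y z] br_antisym[of "br y z" x] br_antisym[of z x] br_antisym[of "br x y" z]
          by (simp add: br_simps add_eq_0_iff algebra_simps)
        then show ?thesis by (metis l.add l.zero)
      qed
      ultimately show ?thesis
        using rel'[of u "br y z" x v] rel'[of u y "br x z" v] rel'[of u "br x y" z v]
        by (simp add: algebra_simps)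
    qed
    \<comment> \<open>The two swaps commute. The correction terms of the two orders differ by the
      same value of \<open>t'\<close>, on the word where both pairs are replaced by their
      brackets.\<close>
    have disjoint: "?c (u, x, y, b @ x' # y' # v) = ?c (u @ x # y # b, x', y', v)"
      if w: "w = u @ x # y # b @ x' # y' # v" and yx: "y \<prec> x" and yx': "y' \<prec> x'" for u x y b x' y' v
    proof -
      have i: "inversions (u @ y # x # b @ x' # y' # v) < inversions w"
        "inversions (u @ x # y # b @ y' # x' # v) < inversions w"
        using w inversions_swap[OF yx, of u "b @ x' # y' # v"]
          inversions_swap[OF yx', of "u @ x # y # b" v] by auto
      have "straighten t (u @ y # x # b @ x' # y' # v)
          = straighten t (u @ y # x # b @ y' # x' # v) + t (u @ y # x # b @ br x' y' # v)"
        using IH[OF yx', of "u @ y # x # b" v] i by simp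
      moreover have "straighten t (u @ x # y # b @ y' # x' # v)
          = straighten t (u @ y # x # b @ y' # x' # v) + t (u @ br x y # b @ y' # x' # v)"
        using IH[OF yx, of u "b @ y' # x' # v"] i by simp
      moreover have "t (u @ br x y # b @ x' # y' # v)
          = t (u @ br x y # b @ y' # x' # v) + t' (u @ br x y # b @ br x' y' # v)"
        using rel'[of "u @ br x y # b" x' y' v] by simp
      moreover have "t (u @ x # y # b @ br x' y' # v)
          = t (u @ y # x # b @ br x' y' # v) + t' (u @ br x y # b @ br x' y' # v)"
        using rel'[of u x y "b @ br x' y' # v"] by simp
      ultimately show ?thesis by (simp add: algebra_simps)
    qed
    have unique: "?c d = ?c d'" if "descent w d" "descent w d'" for d d'
    proof -
      obtain u x y v where d: "d = (u, x, y, v)" by (cases d)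
      obtain u' x' y' v' where d': "d' = (u', x', y', v')" by (cases d')
      have w: "w = u @ x # y # v" "w = u' @ x' # y' # v'" and lt: "y \<prec> x" "y' \<prec> x'"
        using that by (simp_all add: d d')
      from w have "u @ x # y # v = u' @ x' # y' # v'" by simp
      then show ?thesis
      proof (cases rule: two_descents)
        case 1
        then show ?thesis by (simp add: d d')
      next
        case 2
        then show ?thesis using overlap[of u x y y' v'] w lt by (simp add: d d')
      next
        case 3
        then show ?thesis using overlap[of u' x' y' y v] w lt by (simp add: d d')
      next
        case (4 b)
        then show ?thesis using disjoint[of u x y b x' y' v'] w lt by (simp add: d d')
      next
        case (5 b)
        then show ?thesis using disjoint[of u' x' y' b x y v] w lt by (simp add: d d')
      qed
    qed
    have ex: "\<exists>d. descent w d" using less.prems by blast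
    then have "straighten t w = ?c (SOME d. descent w d)"
      by (subst straighten.simps) (simp only: if_True)
    also have "\<dots> = ?c d"
      using less.prems by (intro unique) (metis someI_ex)
    finally show ?case .
  qed
  from this[of "u @ x # y # v" "(u, x, y, v)"] \<open>y \<prec> x\<close> show ?thesis by simp
qed

text \<open>Of two distinct letters one order is a descent, and the other order follows by
  antisymmetry. For equal letters the left side is 0 and the right side vanishes because the bracket
  is alternating, also in characteristic two.\<close>

lemma bracket_relation_straighten:
  assumes lin: "slotwise_linear t" and lin': "slotwise_linear t'" and rel: "bracket_relation t t'"
  shows "bracket_relation (straighten t) t"
  unfolding bracket_relation_def
proof (intro allI)
  fix u x y v
  interpret l: Vector_Spaces.linear scale scale "\<lambda>x. t (u @ x # v)"
    using lin by (simp add: slotwise_linear_def)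
  consider "x = y" | "y \<prec> x" | "x \<prec> y" using prec_total by blast
  then show "straighten t (u @ x # y # v) - straighten t (u @ y # x # v) = t (u @ br x y # v)"
  proof cases
    case 1
    then show ?thesis by (simp add: alternating l.zero)
  next
    case 2
    then show ?thesis by (simp add: straighten_descent[OF assms])
  next
    case 3
    then show ?thesis using br_antisym[of y x] by (simp add: straighten_descent[OF assms 3] l.neg)
  qed
qed

text \<open>On basis words the extension agrees with \<open>s\<close>, so the defect
  \<open>?d\<close> vanishes there. It is linear in each letter of \<open>u\<close>,
  \<open>x\<close>, \<open>y\<close>, \<open>v\<close>, and these are released from the basis in the
  order \<open>v\<close>, \<open>y\<close>, \<open>x\<close>, \<open>u\<close>.\<close>

lemma bracket_relation_multilinear_extension:
  assumes lin: "slotwise_linear t" and rel: "bracket_relation s t"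
  shows "bracket_relation (multilinear_extension s) t"
proof -
  let ?e = "multilinear_extension s"
  let ?d = "\<lambda>u x y v. ?e (u @ x # y # v) - ?e (u @ y # x # v) - t (u @ br x y # v)"
  have e: "Vector_Spaces.linear scale scale (\<lambda>x. ?e (u @ x # v))"
    and t: "Vector_Spaces.linear scale scale (\<lambda>x. t (u @ x # v))" for u v
    using slotwise_linear_multilinear_extension lin by (simp_all add: slotwise_linear_def)
  have e': "Vector_Spaces.linear scale scale (\<lambda>x. ?e (u @ y # x # v))" for u y v
    using e[of "u @ [y]" v] by simp
  have "Vector_Spaces.linear scale scale (\<lambda>v'. ?d u x y (w @ v' # v))" for u x y v w
    using e[of "u @ x # y # w" v] e[of "u @ y # x # w" v] t[of "u @ br x y # w" v]
    by (intro endo.linear_compose_sub) simp_all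
  then have v: "slotwise_linear (?d u x y)" for u x y
    by (simp add: slotwise_linear_def)
  have "Vector_Spaces.linear scale scale (\<lambda>u'. ?d (w @ u' # u) x y v)" for u x y v w
    using e[of w "u @ x # y # v"] e[of w "u @ y # x # v"] t[of w "u @ br x y # v"]
    by (intro endo.linear_compose_sub) simp_all
  then have u: "slotwise_linear (\<lambda>u. ?d u x y v)" for x y v
    by (simp add: slotwise_linear_def)
  have x: "Vector_Spaces.linear scale scale (\<lambda>x. ?d u x y v)" for u y v
    using Vector_Spaces.linear_compose[OF linear_br(2) t] e e'
    by (intro endo.linear_compose_sub) (simp_all add: o_def)
  have y: "Vector_Spaces.linear scale scale (\<lambda>y. ?d u x y v)" for u x v
    using Vector_Spaces.linear_compose[OF linear_br(1) t] e e'
    by (intro endo.linear_compose_sub) (simp_all add: o_def)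
  have uxyv: "?d u x y v = 0" if "set u \<subseteq> B" "x \<in> B" "y \<in> B" "set v \<subseteq> B" for u x y v
  proof -
    have "?e (u @ x # y # v) = s (u @ x # y # v)" "?e (u @ y # x # v) = s (u @ y # x # v)"
      using that by (intro multilinear_extension_basis; auto)+
    then show ?thesis using rel by (simp add: bracket_relation_def)
  qed
  have uxy: "?d u x y v = 0" if "set u \<subseteq> B" "x \<in> B" "y \<in> B" for u x y v
    by (rule slotwise_linear_eq_0[OF v]) (rule uxyv[OF that])
  have ux: "?d u x y v = 0" if "set u \<subseteq> B" "x \<in> B" for u x y v
    by (rule endo.linear_eq_0_on_span[OF y, of B]) (simp_all only: uxy[OF that] span_B UNIV_I)
  have u': "?d u x y v = 0" if "set u \<subseteq> B" for u x y v
    by (rule endo.linear_eq_0_on_span[OF x, of B]) (simp_all only: ux[OF that] span_B UNIV_I)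
  have "?d u x y v = 0" for u x y v
    by (rule slotwise_linear_eq_0[OF u]) (rule u')
  then show ?thesis by (simp add: bracket_relation_def)
qed

text \<open>\<open>pbw n\<close> is only meaningful on words of length \<open>n\<close>: it expands a word in the sorted
  words over \<open>B\<close> modulo the relations \<open>x y - y x = [x, y]\<close> and keeps the part of length one.\<close>

fun pbw :: "nat \<Rightarrow> 'l list \<Rightarrow> 'l" where
  "pbw 0 w = 0"
| "pbw (Suc 0) w = (if length w = 1 then hd w else 0)"
| "pbw (Suc (Suc n)) w = multilinear_extension (straighten (pbw (Suc n))) w"

lemma pbw_properties:
  "slotwise_linear (pbw n) \<and> slotwise_linear (pbw (Suc n)) \<and> bracket_relation (pbw (Suc n)) (pbw n)"
proof (induction n)
  \<comment> \<open>Words containing two adjacent letters have length at least two, where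
    \<open>pbw 1\<close> is 0; so the relation reads 0 = 0.\<close>
  case 0
  have "Vector_Spaces.linear scale scale (\<lambda>x. pbw (Suc 0) (u @ x # v))" for u v
    by (cases u; cases v) (auto simp: Vector_Spaces.linear_iff vector_space_axioms scale_right_distrib)
  moreover have "Vector_Spaces.linear scale scale (\<lambda>x. pbw 0 (u @ x # v))" for u v
    by (auto simp: Vector_Spaces.linear_iff vector_space_axioms scale_right_distrib)
  ultimately show ?case
    by (auto simp: slotwise_linear_def bracket_relation_def)
next
  case (Suc n)
  have "pbw (Suc (Suc n)) = multilinear_extension (straighten (pbw (Suc n)))"
    by (rule ext) simp
  then show ?case
    using Suc slotwise_linear_multilinear_extension
      bracket_relation_multilinear_extension bracket_relation_straighten by metis
qed

end

text \<open>The weak form of the Poincare-Birkhoff-Witt theorem needed here: \<open>\<sigma>\<close> is a linear map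
  \<open>T(L) \<rightarrow> L\<close> which kills the relations of the enveloping algebra and restricts to the identity
  of \<open>L\<close>.\<close>

theorem pbw_projection:
  fixes scale :: "'k::field \<Rightarrow> 'l::ab_group_add \<Rightarrow> 'l"
  assumes "lie_algebra scale br"
  obtains \<sigma> :: "'l list \<Rightarrow> 'l" where
    "\<And>u v. Vector_Spaces.linear scale scale (\<lambda>x. \<sigma> (u @ x # v))"
    "\<And>u x y v. \<sigma> (u @ x # y # v) - \<sigma> (u @ y # x # v) = \<sigma> (u @ br x y # v)"
    "\<And>x. \<sigma> [x] = x"
proof -
  interpret lie_algebra scale br by (rule assms)
  obtain r :: "('l \<times> 'l) set" where "well_order_on UNIV r" using well_order_on by blast
  then have r: "antisym r" "trans r" "total r"
    by (auto simp: well_order_on_def linear_order_on_def partial_order_on_def preorder_on_def)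
  interpret based_lie_algebra scale br "extend_basis {}" "\<lambda>x y. (x, y) \<in> r \<and> x \<noteq> y"
  proof unfold_locales
    show "independent (extend_basis {})" "span (extend_basis {}) = UNIV"
      by (simp_all add: independent_extend_basis independent_empty)
    show "\<And>x. \<not> ((x, x) \<in> r \<and> x \<noteq> x)" by blast
    show "\<And>x y z. (x, y) \<in> r \<and> x \<noteq> y \<Longrightarrow> (y, z) \<in> r \<and> y \<noteq> z \<Longrightarrow> (x, z) \<in> r \<and> x \<noteq> z"
      using antisymD[OF r(1)] transD[OF r(2)] by blast
    show "\<And>x y. x \<noteq> y \<Longrightarrow> (x, y) \<in> r \<and> x \<noteq> y \<or> (y, x) \<in> r \<and> y \<noteq> x"
      using r(3) unfolding total_on_def by blast
  qed
  have lin: "Vector_Spaces.linear scale scale (\<lambda>x. pbw n (u @ x # v))" for n u v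
    using pbw_properties by (simp add: slotwise_linear_def)
  have rel: "pbw (Suc n) (u @ x # y # v) - pbw (Suc n) (u @ y # x # v) = pbw n (u @ br x y # v)"
    for n u x y v
    using pbw_properties by (simp add: bracket_relation_def)
  show thesis
    \<comment> \<open>A swap keeps the length and a bracket lowers it by one, so the graded
      relations become a single relation once the index is the length of the word.\<close>
    by (rule that[of "\<lambda>w. pbw (length w) w"]) (simp_all add: lin rel del: pbw.simps(3))
qed

subsection \<open>Linear extensions and algebras over a field\<close>

abbreviation scalar_mult :: "'k::field \<Rightarrow> ('a \<Rightarrow>\<^sub>0 'k) \<Rightarrow> ('a \<Rightarrow>\<^sub>0 'k)" where
  "scalar_mult c \<equiv> Poly_Mapping.map ((*) c)"

lemma lookup_scalar_mult [simp]: "Poly_Mapping.lookup (scalar_mult c p) a = c * Poly_Mapping.lookup p a"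
  by (simp add: Poly_Mapping.map.rep_eq when_def)

lemma scalar_mult_zero [simp]: "scalar_mult c 0 = 0"
  by (rule poly_mapping_eqI) simp

lemma vector_space_scalar_mult: "vector_space (scalar_mult :: 'k::field \<Rightarrow> ('a \<Rightarrow>\<^sub>0 'k) \<Rightarrow> _)"
  by unfold_locales (auto intro!: poly_mapping_eqI simp: lookup_add algebra_simps)

lemma sum_single_lookup:
  fixes p :: "'a \<Rightarrow>\<^sub>0 'b::comm_monoid_add"
  shows "(\<Sum>a\<in>Poly_Mapping.keys p. Poly_Mapping.single a (Poly_Mapping.lookup p a)) = p"
  by (rule poly_mapping_eqI)
    (auto simp: lookup_sum lookup_single when_def in_keys_iff sum.delta split: if_splits)

text \<open>Reduces multilinear identities to monomials. The support stays inside \<open>S\<close>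
  throughout because the monoid laws hold only on the carrier.\<close>

lemma poly_mapping_additive_induct [consumes 1, case_names zero single add]:
  fixes p :: "'a \<Rightarrow>\<^sub>0 'b::comm_monoid_add"
  assumes p: "Poly_Mapping.keys p \<subseteq> S"
    and zero: "P 0"
    and single: "\<And>a c. a \<in> S \<Longrightarrow> P (Poly_Mapping.single a c)"
    and add: "\<And>p q. Poly_Mapping.keys p \<subseteq> S \<Longrightarrow> Poly_Mapping.keys q \<subseteq> S \<Longrightarrow> P p \<Longrightarrow> P q \<Longrightarrow> P (p + q)"
  shows "P p"
proof -
  let ?s = "\<lambda>A. \<Sum>a\<in>A. Poly_Mapping.single a (Poly_Mapping.lookup p a)"
  have "Poly_Mapping.keys (?s A) \<subseteq> S \<and> P (?s A)" if "finite A" "A \<subseteq> S" for A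
    using that
  proof (induction A)
    case empty
    then show ?case by (simp add: zero)
  next
    case (insert a A)
    let ?x = "Poly_Mapping.single a (Poly_Mapping.lookup p a)"
    have "Poly_Mapping.keys ?x \<subseteq> S" using insert.prems by auto
    then show ?case
      using insert add[of ?x "?s A"] single[of a] Poly_Mapping.keys_add[of ?x "?s A"] by auto
  qed
  then show ?thesis using p by (metis sum_single_lookup finite_keys)
qed

definition linear_extension ::
  "('k::zero \<Rightarrow> 'b \<Rightarrow> 'b::comm_monoid_add) \<Rightarrow> ('c \<Rightarrow> 'b) \<Rightarrow> ('c \<Rightarrow>\<^sub>0 'k) \<Rightarrow> 'b" where
  "linear_extension scale g p = (\<Sum>a\<in>Poly_Mapping.keys p. scale (Poly_Mapping.lookup p a) (g a))"

context vector_space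
begin

lemma linear_extension_superset:
  "finite S \<Longrightarrow> Poly_Mapping.keys p \<subseteq> S \<Longrightarrow>
    linear_extension scale g p = (\<Sum>a\<in>S. scale (Poly_Mapping.lookup p a) (g a))"
  unfolding linear_extension_def
  by (rule sum.mono_neutral_left) (auto simp: in_keys_iff)

lemma linear_extension_zero [simp]: "linear_extension scale g 0 = 0"
  by (simp add: linear_extension_def)

lemma linear_extension_single [simp]: "linear_extension scale g (Poly_Mapping.single a c) = scale c (g a)"
  by (subst linear_extension_superset[of "{a}"]) auto

lemma linear_extension_add: "linear_extension scale g (p + q) = linear_extension scale g p + linear_extension scale g q"
proof -
  let ?S = "Poly_Mapping.keys p \<union> Poly_Mapping.keys q"
  have "Poly_Mapping.keys (p + q) \<subseteq> ?S" by (rule Poly_Mapping.keys_add)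
  then show ?thesis
    by (simp add: linear_extension_superset[of ?S] lookup_add scale_left_distrib sum.distrib)
qed

lemma linear_extension_scalar_mult:
  "linear_extension scale g (scalar_mult c p) = scale c (linear_extension scale g p)"
proof -
  have "Poly_Mapping.keys (scalar_mult c p) \<subseteq> Poly_Mapping.keys p"
    by (auto simp: in_keys_iff)
  then show ?thesis
    by (simp add: linear_extension_superset[of "Poly_Mapping.keys p"] scale_sum_right)
qed

lemma linear_extension_minus:
  "linear_extension scale g (p - q) = linear_extension scale g p - linear_extension scale g q"
  by (metis add_diff_cancel_right' diff_add_cancel linear_extension_add)

lemma linear_extension_fun_zero [simp]: "linear_extension scale (\<lambda>_. 0) p = 0"
  by (simp add: linear_extension_def)

lemma linear_extension_fun_add:
  "linear_extension scale (\<lambda>a. f a + g a) p = linear_extension scale f p + linear_extension scale g p"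
  by (simp add: linear_extension_def scale_right_distrib sum.distrib)

lemma linear_extension_fun_scale:
  "linear_extension scale (\<lambda>a. scale c (f a)) p = scale c (linear_extension scale f p)"
  by (simp add: linear_extension_def scale_sum_right mult.commute)

lemma linear_extension_commute:
  "linear_extension scale (\<lambda>a. linear_extension scale (\<lambda>b. f a b) q) p =
   linear_extension scale (\<lambda>b. linear_extension scale (\<lambda>a. f a b) p) q"
  by (simp add: linear_extension_def scale_sum_right sum.swap[of _ "Poly_Mapping.keys p"] mult.commute)

end

locale k_algebra = ring R
  for R :: "('k::field, 'a) module" (structure) +
  assumes smult_closed [simp, intro]: "x \<in> carrier R \<Longrightarrow> c \<odot> x \<in> carrier R"
    and smult_l_distr: "x \<in> carrier R \<Longrightarrow> (c + d) \<odot> x = c \<odot> x \<oplus> d \<odot> x"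
    and smult_r_distr: "x \<in> carrier R \<Longrightarrow> y \<in> carrier R \<Longrightarrow> c \<odot> (x \<oplus> y) = c \<odot> x \<oplus> c \<odot> y"
    and smult_assoc: "x \<in> carrier R \<Longrightarrow> (c * d) \<odot> x = c \<odot> (d \<odot> x)"
    and smult_one [simp]: "x \<in> carrier R \<Longrightarrow> 1 \<odot> x = x"
    and smult_mult_left: "x \<in> carrier R \<Longrightarrow> y \<in> carrier R \<Longrightarrow> (c \<odot> x) \<otimes> y = c \<odot> (x \<otimes> y)"
    and smult_mult_right: "x \<in> carrier R \<Longrightarrow> y \<in> carrier R \<Longrightarrow> x \<otimes> (c \<odot> y) = c \<odot> (x \<otimes> y)"

subsection \<open>Monoid algebras\<close>

lemma monoid_algebra_simps:
  "carrier (monoid_algebra M) = {p. Poly_Mapping.keys p \<subseteq> carrier M}"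
  "\<one>\<^bsub>monoid_algebra M\<^esub> = Poly_Mapping.single \<one>\<^bsub>M\<^esub> 1"
  "\<zero>\<^bsub>monoid_algebra M\<^esub> = 0"
  "p \<oplus>\<^bsub>monoid_algebra M\<^esub> q = p + q"
  "c \<odot>\<^bsub>monoid_algebra M\<^esub> p = scalar_mult c p"
  by (simp_all add: monoid_algebra_def)

text \<open>Written as an iterated linear extension, the product inherits bilinearity from
  \<open>linear_extension\<close>.\<close>

lemma monoid_algebra_mult:
  fixes p q :: "'a \<Rightarrow>\<^sub>0 'k::field"
  shows "p \<otimes>\<^bsub>monoid_algebra M\<^esub> q =
    linear_extension scalar_mult
      (\<lambda>a. linear_extension scalar_mult (\<lambda>b. Poly_Mapping.single (a \<otimes>\<^bsub>M\<^esub> b) 1) q) p"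
proof -
  interpret pm: vector_space "scalar_mult :: 'k \<Rightarrow> ('a \<Rightarrow>\<^sub>0 'k) \<Rightarrow> _"
    by (rule vector_space_scalar_mult)
  show ?thesis
    by (simp add: monoid_algebra_def linear_extension_def pm.scale_sum_right)
qed

context
  fixes M :: "('a, 'm) monoid_scheme"
begin

interpretation pm: vector_space "scalar_mult :: 'k::field \<Rightarrow> ('a \<Rightarrow>\<^sub>0 'k) \<Rightarrow> _"
  by (rule vector_space_scalar_mult)

lemma monoid_algebra_mult_bilinear:
  fixes p q r :: "'a \<Rightarrow>\<^sub>0 'k::field"
  defines "A \<equiv> monoid_algebra M :: ('k, 'a \<Rightarrow>\<^sub>0 'k) module"
  shows "(p + q) \<otimes>\<^bsub>A\<^esub> r = p \<otimes>\<^bsub>A\<^esub> r + q \<otimes>\<^bsub>A\<^esub> r" "p \<otimes>\<^bsub>A\<^esub> (q + r) = p \<otimes>\<^bsub>A\<^esub> q + p \<otimes>\<^bsub>A\<^esub> r"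
    "scalar_mult c p \<otimes>\<^bsub>A\<^esub> r = scalar_mult c (p \<otimes>\<^bsub>A\<^esub> r)"
    "p \<otimes>\<^bsub>A\<^esub> scalar_mult c q = scalar_mult c (p \<otimes>\<^bsub>A\<^esub> q)"
    "0 \<otimes>\<^bsub>A\<^esub> r = 0" "p \<otimes>\<^bsub>A\<^esub> 0 = 0"
  unfolding A_def monoid_algebra_mult
  by (simp_all add: pm.linear_extension_add pm.linear_extension_fun_add
      pm.linear_extension_scalar_mult pm.linear_extension_fun_scale)

lemma monoid_algebra_mult_single:
  "Poly_Mapping.single a (c :: 'k::field) \<otimes>\<^bsub>monoid_algebra M\<^esub> Poly_Mapping.single b d =
    Poly_Mapping.single (a \<otimes>\<^bsub>M\<^esub> b) (c * d)"
  by (simp add: monoid_algebra_mult mult.commute)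

lemma k_algebra_monoid_algebra:
  assumes "monoid M"
  shows "k_algebra (monoid_algebra M :: ('k::field, 'a \<Rightarrow>\<^sub>0 'k) module)"
proof -
  let ?A = "monoid_algebra M :: ('k, 'a \<Rightarrow>\<^sub>0 'k) module"
  interpret monoid M by (rule assms)
  note s = monoid_algebra_simps monoid_algebra_mult_bilinear monoid_algebra_mult_single
  have keys: "Poly_Mapping.keys (scalar_mult c p) \<subseteq> Poly_Mapping.keys p" for c :: 'k and p :: "'a \<Rightarrow>\<^sub>0 'k"
    by (auto simp: in_keys_iff)
  have add: "Poly_Mapping.keys (p + q) \<subseteq> S"
    if "Poly_Mapping.keys p \<subseteq> S" "Poly_Mapping.keys q \<subseteq> S" for p q :: "'a \<Rightarrow>\<^sub>0 'k" and S
    using that keys_add[of p q] by blast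
  have closed: "p \<otimes>\<^bsub>?A\<^esub> q \<in> carrier ?A" if "p \<in> carrier ?A" "q \<in> carrier ?A" for p q
  proof -
    have p: "Poly_Mapping.keys p \<subseteq> carrier M" and q: "Poly_Mapping.keys q \<subseteq> carrier M"
      using that by (simp_all add: s)
    show ?thesis
      using p
    proof (induction p rule: poly_mapping_additive_induct)
      case (single a c)
      show ?case
        using q
        by (induction q rule: poly_mapping_additive_induct) (use single in \<open>simp_all add: s add\<close>)
    qed (simp_all add: s add)
  qed
  have assoc: "p \<otimes>\<^bsub>?A\<^esub> q \<otimes>\<^bsub>?A\<^esub> r = p \<otimes>\<^bsub>?A\<^esub> (q \<otimes>\<^bsub>?A\<^esub> r)"
    if "p \<in> carrier ?A" "q \<in> carrier ?A" "r \<in> carrier ?A" for p q r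
  proof -
    have p: "Poly_Mapping.keys p \<subseteq> carrier M" and q: "Poly_Mapping.keys q \<subseteq> carrier M"
      and r: "Poly_Mapping.keys r \<subseteq> carrier M"
      using that by (simp_all add: s)
    show ?thesis
      using p
    proof (induction p rule: poly_mapping_additive_induct)
      case (single a c)
      note a = this
      show ?case
        using q
      proof (induction q rule: poly_mapping_additive_induct)
        case (single b d)
        note b = this
        show ?case
          using r
          by (induction r rule: poly_mapping_additive_induct)
            (use a b in \<open>simp_all add: s m_assoc mult.assoc\<close>)
      qed (simp_all add: s)
    qed (simp_all add: s)
  qed
  have one: "\<one>\<^bsub>?A\<^esub> \<otimes>\<^bsub>?A\<^esub> p = p \<and> p \<otimes>\<^bsub>?A\<^esub> \<one>\<^bsub>?A\<^esub> = p" if "p \<in> carrier ?A" for p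
  proof -
    have "Poly_Mapping.keys p \<subseteq> carrier M" using that by (simp add: s)
    then show ?thesis
      by (induction p rule: poly_mapping_additive_induct) (simp_all add: s)
  qed
  have "abelian_group ?A"
  proof (rule abelian_groupI)
    show "\<exists>y\<in>carrier ?A. y \<oplus>\<^bsub>?A\<^esub> x = \<zero>\<^bsub>?A\<^esub>" if "x \<in> carrier ?A" for x
      using that by (intro bexI[of _ "- x"]) (auto simp: s in_keys_iff)
  qed (simp_all add: s add add_ac)
  moreover have "Group.monoid ?A"
    using closed assoc one by (intro monoidI) (auto simp: s)
  ultimately have "ring ?A"
    by (intro ringI) (auto simp: s)
  then show ?thesis
    unfolding k_algebra_def k_algebra_axioms_def
    using order_trans[OF keys] by (simp add: s pm.scale_left_distrib pm.scale_right_distrib)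
qed

end

subsection \<open>Quotient algebras\<close>

text \<open>\<open>quotient_algebra\<close> copies the ring fields of \<open>Quot\<close> into a
  record of another type; the ring axioms see only those fields.\<close>

lemma ring_cong_fields:
  fixes A :: "('a, 'm) ring_scheme" and B :: "('a, 'n) ring_scheme"
  assumes "ring A"
    and eq: "carrier B = carrier A" "monoid.mult B = monoid.mult A" "monoid.one B = monoid.one A"
      "ring.zero B = ring.zero A" "ring.add B = ring.add A"
  shows "ring B"
proof -
  interpret A: ring A by (rule assms)
  have "abelian_group B"
    by (rule abelian_groupI) (use A.add.l_inv_ex in \<open>simp_all add: eq A.a_ac\<close>)
  moreover have "Group.monoid B"
    by (rule monoidI) (simp_all add: eq A.m_assoc)
  ultimately show ?thesis
    by (rule ringI) (simp_all add: eq A.l_distr A.r_distr)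
qed

context k_algebra
begin

context
  fixes I assumes I: "ideal I R"
begin

interpretation ideal I R by (rule I)

text \<open>In a unital algebra, scaling by c is multiplication by c 1, so a ring ideal is a
  subspace. This is why quotients by \<open>genideal\<close> carry a scalar multiplication.\<close>

lemma smult_mem_ideal:
  assumes "x \<in> I" shows "c \<odot> x \<in> I"
proof -
  have x: "x \<in> carrier R" using assms by (rule a_Hcarr)
  have "c \<odot> x = (c \<odot> \<one>) \<otimes> x" using x by (simp add: smult_mult_left)
  then show ?thesis using assms by (simp add: I_l_closed)
qed

lemma quotient_algebra_smult:
  assumes x: "x \<in> carrier R"
  shows "c \<odot>\<^bsub>quotient_algebra R I\<^esub> (I +> x) = I +> (c \<odot> x)"
proof -
  have "I +> (c \<odot> y) = I +> (c \<odot> x)" if y: "y \<in> I +> x" for y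
  proof -
    obtain i where i: "i \<in> I" "y = i \<oplus> x" using y by (auto simp: a_r_coset_def')
    have "c \<odot> y = c \<odot> i \<oplus> c \<odot> x" using i x by (simp add: smult_r_distr a_Hcarr)
    then have "c \<odot> y \<in> I +> (c \<odot> x)"
      using smult_mem_ideal[OF i(1)] by (auto simp: a_r_coset_def')
    then show ?thesis using x by (simp add: a_repr_independence')
  qed
  moreover have "x \<in> I +> x" using x by (rule a_rcos_self)
  ultimately have "(\<Union>y\<in>I +> x. I +> (c \<odot> y)) = I +> (c \<odot> x)" by blast
  then show ?thesis by (simp add: quotient_algebra_def)
qed

lemma quotient_algebra_ops:
  assumes "x \<in> carrier R" "y \<in> carrier R"
  shows "(I +> x) \<oplus>\<^bsub>quotient_algebra R I\<^esub> (I +> y) = I +> (x \<oplus> y)"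
    "(I +> x) \<otimes>\<^bsub>quotient_algebra R I\<^esub> (I +> y) = I +> (x \<otimes> y)"
  using assms by (simp_all add: quotient_algebra_def FactRing_def rcoset_mult_add a_rcos_sum)

lemma quotient_algebra_simps:
  "carrier (quotient_algebra R I) = (\<lambda>x. I +> x) ` carrier R"
  "\<one>\<^bsub>quotient_algebra R I\<^esub> = I +> \<one>"
  "\<zero>\<^bsub>quotient_algebra R I\<^esub> = I"
  by (auto simp: quotient_algebra_def FactRing_def A_RCOSETS_def')

lemma k_algebra_quotient_algebra: "k_algebra (quotient_algebra R I)"
proof -
  have "ring (quotient_algebra R I)"
    by (rule ring_cong_fields[OF quotient_is_ring]) (simp_all add: quotient_algebra_def)
  then show ?thesis
    unfolding k_algebra_def k_algebra_axioms_def
    by (auto simp: quotient_algebra_simps quotient_algebra_ops quotient_algebra_smult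
        smult_l_distr smult_r_distr smult_assoc smult_mult_left smult_mult_right)
qed

end

end

lemma monoid_algebra_minus:
  fixes p q :: "'a \<Rightarrow>\<^sub>0 'k::field"
  assumes "monoid M" "q \<in> carrier (monoid_algebra M)"
  shows "p \<ominus>\<^bsub>monoid_algebra M\<^esub> q = p - q"
proof -
  interpret k_algebra "monoid_algebra M :: ('k, 'a \<Rightarrow>\<^sub>0 'k) module"
    by (rule k_algebra_monoid_algebra[OF assms(1)])
  have "- q \<in> carrier (monoid_algebra M)"
    using assms(2) by (auto simp: monoid_algebra_simps in_keys_iff)
  then have "\<ominus>\<^bsub>monoid_algebra M\<^esub> q = - q"
    using assms(2) by (intro minus_equality) (simp_all add: monoid_algebra_simps)
  then show ?thesis by (simp add: a_minus_def monoid_algebra_simps)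
qed

context k_algebra
begin

lemma smult_zero_left [simp]: "x \<in> carrier R \<Longrightarrow> 0 \<odot> x = \<zero>"
  using smult_l_distr[of x 0 0] by (metis add.l_cancel_one add_0 smult_closed)

lemma smult_zero_right [simp]: "c \<odot> \<zero> = \<zero>"
  using smult_r_distr[of \<zero> \<zero> c] by (metis add.l_cancel_one l_zero smult_closed zero_closed)

text \<open>The counterpart of \<open>linear_extension\<close> for targets given by a carrier. Over
  pairs it is the sum in the Sweedler clause of \<open>extended_product\<close>.\<close>

definition combination :: "('c \<Rightarrow> 'a) \<Rightarrow> ('c \<Rightarrow>\<^sub>0 'k) \<Rightarrow> 'a" where
  "combination g p = finsum R (\<lambda>a. Poly_Mapping.lookup p a \<odot> g a) (Poly_Mapping.keys p)"

lemma combination_superset: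
  assumes "finite S" "Poly_Mapping.keys p \<subseteq> S" "g \<in> S \<rightarrow> carrier R"
  shows "combination g p = finsum R (\<lambda>a. Poly_Mapping.lookup p a \<odot> g a) S"
  unfolding combination_def
  by (rule add.finprod_mono_neutral_cong_left) (use assms in \<open>auto simp: in_keys_iff Pi_iff\<close>)

lemma combination_closed [simp]:
  "g \<in> Poly_Mapping.keys p \<rightarrow> carrier R \<Longrightarrow> combination g p \<in> carrier R"
  unfolding combination_def by (rule finsum_closed) auto

lemma combination_zero [simp]: "combination g 0 = \<zero>"
  by (simp add: combination_def)

lemma combination_single [simp]:
  "g a \<in> carrier R \<Longrightarrow> combination g (Poly_Mapping.single a c) = c \<odot> g a"
  by (subst combination_superset[of "{a}"]) auto

lemma combination_add:
  assumes g: "g \<in> Poly_Mapping.keys p \<union> Poly_Mapping.keys q \<rightarrow> carrier R"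
  shows "combination g (p + q) = combination g p \<oplus> combination g q"
proof -
  let ?S = "Poly_Mapping.keys p \<union> Poly_Mapping.keys q"
  have S: "Poly_Mapping.keys (p + q) \<subseteq> ?S" "finite ?S" by (simp_all add: Poly_Mapping.keys_add)
  have "combination g (p + q) = finsum R (\<lambda>a. Poly_Mapping.lookup (p + q) a \<odot> g a) ?S"
    by (rule combination_superset[OF S(2,1) g])
  also have "\<dots> = finsum R (\<lambda>a. Poly_Mapping.lookup p a \<odot> g a \<oplus> Poly_Mapping.lookup q a \<odot> g a) ?S"
    by (rule finsum_cong') (use g in \<open>auto simp: lookup_add smult_l_distr Pi_iff\<close>)
  also have "\<dots> = finsum R (\<lambda>a. Poly_Mapping.lookup p a \<odot> g a) ?S \<oplus>
      finsum R (\<lambda>a. Poly_Mapping.lookup q a \<odot> g a) ?S"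
    by (rule finsum_addf) (use g in \<open>auto simp: Pi_iff\<close>)
  also have "\<dots> = combination g p \<oplus> combination g q"
    using g by (simp add: combination_superset[of ?S])
  finally show ?thesis .
qed

lemma combination_scalar_mult:
  assumes g: "g \<in> Poly_Mapping.keys p \<rightarrow> carrier R"
  shows "combination g (scalar_mult c p) = c \<odot> combination g p"
proof -
  have g': "g \<in> A \<rightarrow> carrier R" if "A \<subseteq> Poly_Mapping.keys p" for A
    using g that by auto
  have "Poly_Mapping.keys p \<subseteq> Poly_Mapping.keys p" by simp
  then show ?thesis
  proof (induction p rule: poly_mapping_additive_induct)
    case zero
    then show ?case by simp
  next
    case (single a d)
    then show ?case using g by (simp add: Pi_iff smult_assoc)
  next
    case (add p' q')
    have "scalar_mult c (p' + q') = scalar_mult c p' + scalar_mult c q'"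
      by (rule poly_mapping_eqI) (simp add: lookup_add algebra_simps)
    moreover have "Poly_Mapping.keys (scalar_mult c p') \<subseteq> Poly_Mapping.keys p'"
      "Poly_Mapping.keys (scalar_mult c q') \<subseteq> Poly_Mapping.keys q'"
      by (auto simp: in_keys_iff)
    ultimately show ?case
      using add by (simp add: combination_add g' smult_r_distr)
  qed
qed

end

lemma algebra_homD:
  assumes "h \<in> algebra_hom A B"
  shows "x \<in> carrier A \<Longrightarrow> h x \<in> carrier B"
    "x \<in> carrier A \<Longrightarrow> y \<in> carrier A \<Longrightarrow> h (x \<otimes>\<^bsub>A\<^esub> y) = h x \<otimes>\<^bsub>B\<^esub> h y"
    "x \<in> carrier A \<Longrightarrow> y \<in> carrier A \<Longrightarrow> h (x \<oplus>\<^bsub>A\<^esub> y) = h x \<oplus>\<^bsub>B\<^esub> h y"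
    "h \<one>\<^bsub>A\<^esub> = \<one>\<^bsub>B\<^esub>"
    "x \<in> carrier A \<Longrightarrow> h (c \<odot>\<^bsub>A\<^esub> x) = c \<odot>\<^bsub>B\<^esub> h x"
  using assms unfolding algebra_hom_def ring_hom_def by auto

subsection \<open>The tensor algebra\<close>

lemma monoid_lists: "monoid \<lparr>carrier = UNIV, monoid.mult = (@), monoid.one = []\<rparr>"
  by (rule monoidI) simp_all

interpretation free_algebra: k_algebra "free_algebra :: ('k::field, 'v list \<Rightarrow>\<^sub>0 'k) module"
  unfolding free_algebra_def by (rule k_algebra_monoid_algebra[OF monoid_lists])

lemma free_algebra_simps:
  "carrier free_algebra = UNIV"
  "\<one>\<^bsub>free_algebra\<^esub> = Poly_Mapping.single [] 1"
  "\<zero>\<^bsub>free_algebra\<^esub> = 0"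
  "p \<oplus>\<^bsub>free_algebra\<^esub> q = p + q"
  "c \<odot>\<^bsub>free_algebra\<^esub> p = scalar_mult c p"
  "p \<ominus>\<^bsub>free_algebra\<^esub> q = p - q"
  "Poly_Mapping.single v c \<otimes>\<^bsub>free_algebra\<^esub> Poly_Mapping.single w d = Poly_Mapping.single (v @ w) (c * d)"
  by (simp_all add: free_algebra_def monoid_algebra_simps monoid_algebra_minus monoid_lists
      monoid_algebra_mult_single)

lemma free_algebra_mult_bilinear:
  "(p + q) \<otimes>\<^bsub>free_algebra\<^esub> r = p \<otimes>\<^bsub>free_algebra\<^esub> r + q \<otimes>\<^bsub>free_algebra\<^esub> r"
  "p \<otimes>\<^bsub>free_algebra\<^esub> (q + r) = p \<otimes>\<^bsub>free_algebra\<^esub> q + p \<otimes>\<^bsub>free_algebra\<^esub> r"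
  "0 \<otimes>\<^bsub>free_algebra\<^esub> r = 0" "p \<otimes>\<^bsub>free_algebra\<^esub> 0 = 0"
  unfolding free_algebra_def by (rule monoid_algebra_mult_bilinear)+

definition tensor_class :: "('k::field \<Rightarrow> 'v::ab_group_add \<Rightarrow> 'v) \<Rightarrow> ('v list \<Rightarrow>\<^sub>0 'k) \<Rightarrow> ('v list \<Rightarrow>\<^sub>0 'k) set" where
  "tensor_class s p = linearity_ideal s +>\<^bsub>free_algebra\<^esub> p"

lemma ideal_linearity_ideal: "ideal (linearity_ideal s) free_algebra"
  unfolding linearity_ideal_def
  by (rule free_algebra.genideal_ideal) (simp add: free_algebra_simps)

lemma k_algebra_tensor_algebra: "k_algebra (tensor_algebra s)"
  unfolding tensor_algebra_def
  by (rule free_algebra.k_algebra_quotient_algebra[OF ideal_linearity_ideal])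

lemma tensor_class_simps:
  "carrier (tensor_algebra s) = range (tensor_class s)"
  "tensor_class s p \<oplus>\<^bsub>tensor_algebra s\<^esub> tensor_class s q = tensor_class s (p + q)"
  "tensor_class s p \<otimes>\<^bsub>tensor_algebra s\<^esub> tensor_class s q = tensor_class s (p \<otimes>\<^bsub>free_algebra\<^esub> q)"
  "c \<odot>\<^bsub>tensor_algebra s\<^esub> tensor_class s p = tensor_class s (scalar_mult c p)"
  "\<one>\<^bsub>tensor_algebra s\<^esub> = tensor_class s (Poly_Mapping.single [] 1)"
  unfolding tensor_algebra_def tensor_class_def
  using free_algebra.quotient_algebra_simps[OF ideal_linearity_ideal]
    free_algebra.quotient_algebra_ops[OF ideal_linearity_ideal]
    free_algebra.quotient_algebra_smult[OF ideal_linearity_ideal]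
  by (simp_all add: free_algebra_simps)

lemma tensor_class_eq_iff: "tensor_class s p = tensor_class s q \<longleftrightarrow> p - q \<in> linearity_ideal s"
  using free_algebra.quotient_eq_iff_same_a_r_cos[OF ideal_linearity_ideal, of p q]
  by (simp add: tensor_class_def free_algebra_simps)

lemma incl_eq: "incl s x = tensor_class s (Poly_Mapping.single [x] 1)"
  by (simp add: incl_def tensor_class_def)

lemma incl_closed [simp]: "incl s x \<in> carrier (tensor_algebra s)"
  by (simp add: incl_eq tensor_class_simps)

lemma incl_add: "incl s (x + y) = incl s x \<oplus>\<^bsub>tensor_algebra s\<^esub> incl s y"
proof -
  have "Poly_Mapping.single [x + y] 1 - Poly_Mapping.single [x] 1 - Poly_Mapping.single [y] 1
    \<in> linearity_ideal s"
    unfolding linearity_ideal_def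
    by (rule set_mp[OF free_algebra.genideal_self]) (auto simp: free_algebra_simps)
  then show ?thesis
    by (simp add: incl_eq tensor_class_simps tensor_class_eq_iff diff_diff_add)
qed

lemma incl_scale: "incl s (s c x) = c \<odot>\<^bsub>tensor_algebra s\<^esub> incl s x"
proof -
  have "Poly_Mapping.single [s c x] 1 - Poly_Mapping.single [x] c \<in> linearity_ideal s"
    unfolding linearity_ideal_def
    by (rule set_mp[OF free_algebra.genideal_self]) (auto simp: free_algebra_simps)
  then show ?thesis
    by (simp add: incl_eq tensor_class_simps tensor_class_eq_iff)
qed

text \<open>Words span T(V) and arise by multiplying with letters on the left. This form suits both
  algebra morphisms and derivations, whose value on x Y is determined by the data at x and at
  Y.\<close>

lemma tensor_algebra_induct [consumes 1, case_names zero one incl add smult]: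
  assumes "X \<in> carrier (tensor_algebra s)"
    and "P \<zero>\<^bsub>tensor_algebra s\<^esub>"
    and "P \<one>\<^bsub>tensor_algebra s\<^esub>"
    and "\<And>x Y. Y \<in> carrier (tensor_algebra s) \<Longrightarrow> P Y \<Longrightarrow> P (incl s x \<otimes>\<^bsub>tensor_algebra s\<^esub> Y)"
    and "\<And>X Y. X \<in> carrier (tensor_algebra s) \<Longrightarrow> Y \<in> carrier (tensor_algebra s) \<Longrightarrow> P X \<Longrightarrow> P Y \<Longrightarrow>
      P (X \<oplus>\<^bsub>tensor_algebra s\<^esub> Y)"
    and "\<And>c X. X \<in> carrier (tensor_algebra s) \<Longrightarrow> P X \<Longrightarrow> P (c \<odot>\<^bsub>tensor_algebra s\<^esub> X)"
  shows "P X"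
proof -
  interpret T: k_algebra "tensor_algebra s" by (rule k_algebra_tensor_algebra)
  have carrier [simp]: "tensor_class s p \<in> carrier (tensor_algebra s)" for p
    by (simp add: tensor_class_simps)
  have word: "P (tensor_class s (Poly_Mapping.single w 1))" for w
  proof (induction w)
    case Nil
    show ?case using assms(3) by (simp add: tensor_class_simps)
  next
    case (Cons x w)
    then show ?case
      using assms(4)[of "tensor_class s (Poly_Mapping.single w 1)" x]
      by (simp add: incl_eq tensor_class_simps(3) free_algebra_simps)
  qed
  have "P (tensor_class s p)" for p
  proof -
    have "Poly_Mapping.keys p \<subseteq> UNIV" by simp
    then show ?thesis
    proof (induction p rule: poly_mapping_additive_induct)
      case zero
      have "0 \<odot>\<^bsub>tensor_algebra s\<^esub> tensor_class s 0 = tensor_class s 0"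
        unfolding tensor_class_simps by (simp add: map_eq_zero_iff)
      then have "tensor_class s 0 = \<zero>\<^bsub>tensor_algebra s\<^esub>" by simp
      then show ?case using assms(2) by simp
    next
      case (single w c)
      then show ?case
        using assms(6)[OF carrier word, of c w] by (simp add: tensor_class_simps(4))
    next
      case (add p q)
      then show ?case using assms(5)[OF carrier carrier, of p q] by (simp add: tensor_class_simps(2))
    qed
  qed
  then show ?thesis using assms(1) by (auto simp: tensor_class_simps)
qed

lemma tensor_algebra_hom_unique:
  assumes "k_algebra R" and D: "D \<in> algebra_hom (tensor_algebra s) R"
    and E: "E \<in> algebra_hom (tensor_algebra s) R"
    and incl: "\<And>x. D (incl s x) = E (incl s x)" and X: "X \<in> carrier (tensor_algebra s)"
  shows "D X = E X"
proof -
  interpret T: k_algebra "tensor_algebra s" by (rule k_algebra_tensor_algebra)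
  interpret R: k_algebra R by (rule assms)
  show ?thesis
    using X
  proof (induction rule: tensor_algebra_induct)
    case zero
    have "D (0 \<odot>\<^bsub>tensor_algebra s\<^esub> \<one>\<^bsub>tensor_algebra s\<^esub>) = E (0 \<odot>\<^bsub>tensor_algebra s\<^esub> \<one>\<^bsub>tensor_algebra s\<^esub>)"
      by (simp only: algebra_homD[OF D] algebra_homD[OF E] T.one_closed)
    then show ?case by simp
  qed (simp_all add: algebra_homD[OF D] algebra_homD[OF E] incl)
qed

text \<open>The universal property of T(V): words are evaluated by \<open>g\<close>,
  \<open>E\<close> extends this to the free algebra, and linearity of \<open>d\<close> puts the
  linearity ideal into the kernel, so \<open>E\<close> descends to classes through any
  representative.\<close>

lemma (in k_algebra) tensor_algebra_hom_exists:
  assumes d: "\<And>x. d x \<in> carrier R"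
    and d_add: "\<And>x y. d (x + y) = d x \<oplus> d y"
    and d_scale: "\<And>c x. d (s c x) = c \<odot> d x"
  obtains D where "D \<in> algebra_hom (tensor_algebra s) R" "\<And>x. D (incl s x) = d x"
proof -
  define g where "g = (\<lambda>w. foldr (\<lambda>x y. d x \<otimes> y) w \<one>)"
  have g [simp]: "g w \<in> carrier R" for w
    unfolding g_def by (induction w) (simp_all add: d)
  have g_append: "g (v @ w) = g v \<otimes> g w" for v w
    by (induction v) (use g in \<open>simp_all add: g_def d m_assoc\<close>)
  have "g [] = \<one>" by (simp add: g_def)
  have [simp]: "g [x] = d x" for x by (simp add: g_def d)
  define E where "E = combination g"
  have E_closed [simp]: "E p \<in> carrier R" for p
    by (simp add: E_def)
  have E_zero: "E 0 = \<zero>" by (simp add: E_def)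
  have E_add: "E (p + q) = E p \<oplus> E q" for p q
    by (simp add: E_def combination_add)
  have E_scale: "E (scalar_mult c p) = c \<odot> E p" for c p
    by (simp add: E_def combination_scalar_mult)
  have E_single: "E (Poly_Mapping.single w c) = c \<odot> g w" for w c
    by (simp add: E_def)
  have E_mult: "E (p \<otimes>\<^bsub>free_algebra\<^esub> q) = E p \<otimes> E q" for p q
  proof -
    have "Poly_Mapping.keys p \<subseteq> UNIV" by simp
    then show ?thesis
    proof (induction p rule: poly_mapping_additive_induct)
      case zero
      show ?case by (simp add: free_algebra_mult_bilinear E_zero)
    next
      case (single v c)
      have "Poly_Mapping.keys q \<subseteq> UNIV" by simp
      then show ?case
      proof (induction q rule: poly_mapping_additive_induct)
        case (single w d)
        then show ?case
          by (simp add: free_algebra_simps E_single g_append smult_mult_left smult_mult_right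
              smult_assoc[symmetric] mult.commute)
      qed (simp_all add: free_algebra_mult_bilinear E_zero E_add r_distr)
    next
      case (add p q)
      then show ?case by (simp add: free_algebra_mult_bilinear E_add l_distr)
    qed
  qed
  have E_one: "E \<one>\<^bsub>free_algebra\<^esub> = \<one>"
    by (simp add: free_algebra_simps E_single \<open>g [] = \<one>\<close>)
  interpret hom: ring_hom_ring free_algebra R E
    by (rule ring_hom_ringI)
      (simp_all add: free_algebra.ring_axioms ring_axioms E_mult E_one, simp add: free_algebra_simps E_add)
  have E_minus: "E (p - q) = E p \<ominus> E q" for p q
    using E_add[of "p - q" q] by (simp add: minus_eq a_assoc r_neg)
  have kernel: "a_kernel free_algebra R E = {p. E p = \<zero>}"
    unfolding a_kernel_def' free_algebra_simps(1) by blast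
  have "linearity_ideal s \<subseteq> a_kernel free_algebra R E"
    unfolding linearity_ideal_def
  proof (rule free_algebra.genideal_minimal[OF hom.kernel_is_ideal])
    show "{Poly_Mapping.single [x + y] 1 - Poly_Mapping.single [x] 1 - Poly_Mapping.single [y] 1 | x y. True} \<union>
        {Poly_Mapping.single [s c x] 1 - Poly_Mapping.single [x] c | c x. True} \<subseteq> a_kernel free_algebra R E"
    proof -
      have "d x \<oplus> d y \<ominus> d x \<ominus> d y = \<zero>" for x y
        using d[of x] d[of y] by algebra
      then have "E (Poly_Mapping.single [x + y] 1 - Poly_Mapping.single [x] 1 - Poly_Mapping.single [y] 1) = \<zero>"
        for x y
        by (simp add: E_minus E_single d d_add)
      moreover have "E (Poly_Mapping.single [s c x] 1 - Poly_Mapping.single [x] c) = \<zero>" for c x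
        by (simp add: E_minus E_single d d_scale minus_eq r_neg)
      ultimately show ?thesis unfolding kernel by blast
    qed
  qed
  have E_cong: "E p = E q" if "tensor_class s p = tensor_class s q" for p q
  proof -
    have "E (p - q) = \<zero>"
      using that \<open>linearity_ideal s \<subseteq> a_kernel free_algebra R E\<close>
      unfolding tensor_class_eq_iff kernel by blast
    then show ?thesis using E_add[of "p - q" q] by simp
  qed
  define D where "D X = E (SOME p. X = tensor_class s p)" for X
  have D: "D (tensor_class s p) = E p" for p
    unfolding D_def by (rule E_cong) (metis (mono_tags, lifting) someI)
  have "D \<in> algebra_hom (tensor_algebra s) R"
    unfolding algebra_hom_def
    by (auto intro!: ring_hom_memI simp: tensor_class_simps D E_mult E_add E_scale E_single \<open>g [] = \<one>\<close>)
  moreover have "D (incl s x) = d x" for x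
    by (simp add: incl_eq D E_single d)
  ultimately show thesis by (rule that)
qed

subsection \<open>Tensor products of algebras\<close>

context
  fixes A :: "('k::field, 'a) module" and B :: "('k, 'b) module"
  assumes A: "k_algebra A" and B: "k_algebra B"
begin

interpretation A: k_algebra A by (rule A)
interpretation B: k_algebra B by (rule B)

lemma monoid_pairs: "monoid (A \<times>\<times> B)"
  by (rule DirProd_monoid) (rule A.monoid_axioms B.monoid_axioms)+

interpretation AB: k_algebra "monoid_algebra (A \<times>\<times> B) :: ('k, ('a \<times> 'b) \<Rightarrow>\<^sub>0 'k) module"
  by (rule k_algebra_monoid_algebra[OF monoid_pairs])

lemma single_pair_carrier:
  "a \<in> carrier A \<Longrightarrow> b \<in> carrier B \<Longrightarrow> Poly_Mapping.single (a, b) c \<in> carrier (monoid_algebra (A \<times>\<times> B))"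
  by (simp add: monoid_algebra_simps)

lemma bilinearity_generators_carrier:
  "({Poly_Mapping.single (a \<oplus>\<^bsub>A\<^esub> a', b) 1 - Poly_Mapping.single (a, b) 1 - Poly_Mapping.single (a', b) 1
        | a a' b. a \<in> carrier A \<and> a' \<in> carrier A \<and> b \<in> carrier B} \<union>
     {Poly_Mapping.single (a, b \<oplus>\<^bsub>B\<^esub> b') 1 - Poly_Mapping.single (a, b) 1 - Poly_Mapping.single (a, b') 1
        | a b b'. a \<in> carrier A \<and> b \<in> carrier B \<and> b' \<in> carrier B} \<union>
     {Poly_Mapping.single (c \<odot>\<^bsub>A\<^esub> a, b) 1 - Poly_Mapping.single (a, b) c
        | c a b. a \<in> carrier A \<and> b \<in> carrier B} \<union>
     {Poly_Mapping.single (a, c \<odot>\<^bsub>B\<^esub> b) 1 - Poly_Mapping.single (a, b) c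
        | c a b. a \<in> carrier A \<and> b \<in> carrier B})
   \<subseteq> carrier (monoid_algebra (A \<times>\<times> B))" (is "?G \<subseteq> _")
proof -
  have minus: "p - q \<in> carrier (monoid_algebra (A \<times>\<times> B))"
    if "p \<in> carrier (monoid_algebra (A \<times>\<times> B))" "q \<in> carrier (monoid_algebra (A \<times>\<times> B))"
    for p q :: "('a \<times> 'b) \<Rightarrow>\<^sub>0 'k"
    using AB.minus_closed[OF that] by (simp add: monoid_algebra_minus[OF monoid_pairs that(2)])
  show ?thesis by (auto intro!: minus single_pair_carrier)
qed

lemma ideal_bilinearity_ideal: "ideal (bilinearity_ideal A B) (monoid_algebra (A \<times>\<times> B))"
  unfolding bilinearity_ideal_def by (rule AB.genideal_ideal[OF bilinearity_generators_carrier])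

lemma k_algebra_tensor_product: "k_algebra (tensor_product A B)"
  unfolding tensor_product_def by (rule AB.k_algebra_quotient_algebra[OF ideal_bilinearity_ideal])

lemma pure_tensor_closed [simp]:
  "a \<in> carrier A \<Longrightarrow> b \<in> carrier B \<Longrightarrow> pure_tensor A B a b \<in> carrier (tensor_product A B)"
  using single_pair_carrier[of a b 1]
  by (auto simp: tensor_product_def pure_tensor_def AB.quotient_algebra_simps[OF ideal_bilinearity_ideal])

lemma pure_tensor_mult:
  assumes "a \<in> carrier A" "b \<in> carrier B" "a' \<in> carrier A" "b' \<in> carrier B"
  shows "pure_tensor A B a b \<otimes>\<^bsub>tensor_product A B\<^esub> pure_tensor A B a' b' =
    pure_tensor A B (a \<otimes>\<^bsub>A\<^esub> a') (b \<otimes>\<^bsub>B\<^esub> b')"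
  using assms
  by (simp add: tensor_product_def pure_tensor_def single_pair_carrier monoid_algebra_mult_single
      AB.quotient_algebra_ops[OF ideal_bilinearity_ideal])

lemma pure_tensor_bilinear:
  assumes "a \<in> carrier A" "b \<in> carrier B"
  shows "a' \<in> carrier A \<Longrightarrow> pure_tensor A B (a \<oplus>\<^bsub>A\<^esub> a') b =
      pure_tensor A B a b \<oplus>\<^bsub>tensor_product A B\<^esub> pure_tensor A B a' b"
    and "b' \<in> carrier B \<Longrightarrow> pure_tensor A B a (b \<oplus>\<^bsub>B\<^esub> b') =
      pure_tensor A B a b \<oplus>\<^bsub>tensor_product A B\<^esub> pure_tensor A B a b'"
    and "pure_tensor A B (c \<odot>\<^bsub>A\<^esub> a) b = c \<odot>\<^bsub>tensor_product A B\<^esub> pure_tensor A B a b"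
    and "pure_tensor A B a (c \<odot>\<^bsub>B\<^esub> b) = c \<odot>\<^bsub>tensor_product A B\<^esub> pure_tensor A B a b"
proof -
  let ?M = "monoid_algebra (A \<times>\<times> B) :: ('k, ('a \<times> 'b) \<Rightarrow>\<^sub>0 'k) module"
  let ?I = "bilinearity_ideal A B"
  note gen = set_mp[OF AB.genideal_self[OF bilinearity_generators_carrier], folded bilinearity_ideal_def]
  have eqI: "?I +>\<^bsub>?M\<^esub> p = ?I +>\<^bsub>?M\<^esub> q" if "p - q \<in> ?I" "p \<in> carrier ?M" "q \<in> carrier ?M" for p q
    using AB.quotient_eq_iff_same_a_r_cos[OF ideal_bilinearity_ideal that(2,3)] that
    by (simp add: monoid_algebra_minus[OF monoid_pairs])
  note ops = AB.quotient_algebra_ops[OF ideal_bilinearity_ideal]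
    AB.quotient_algebra_smult[OF ideal_bilinearity_ideal] monoid_algebra_simps(4,5)
  have sum: "pure_tensor A B a b \<oplus>\<^bsub>tensor_product A B\<^esub> pure_tensor A B a' b' =
      ?I +>\<^bsub>?M\<^esub> (Poly_Mapping.single (a, b) 1 + Poly_Mapping.single (a', b') 1)"
    and sum_carrier: "Poly_Mapping.single (a, b) 1 + Poly_Mapping.single (a', b') 1 \<in> carrier ?M"
    if "a \<in> carrier A" "b \<in> carrier B" "a' \<in> carrier A" "b' \<in> carrier B" for a b a' b'
    using that AB.a_closed[OF single_pair_carrier[of a b 1] single_pair_carrier[of a' b' 1]]
    by (simp_all add: tensor_product_def pure_tensor_def single_pair_carrier ops)
  have smult: "c \<odot>\<^bsub>tensor_product A B\<^esub> pure_tensor A B a b = ?I +>\<^bsub>?M\<^esub> Poly_Mapping.single (a, b) c"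
    using assms by (simp add: tensor_product_def pure_tensor_def single_pair_carrier ops)
  show "pure_tensor A B (a \<oplus>\<^bsub>A\<^esub> a') b =
      pure_tensor A B a b \<oplus>\<^bsub>tensor_product A B\<^esub> pure_tensor A B a' b" if "a' \<in> carrier A"
    unfolding sum[OF assms that assms(2)] unfolding pure_tensor_def
    by (rule eqI) (use assms that in \<open>auto intro!: gen sum_carrier single_pair_carrier simp flip: diff_diff_add\<close>)
  show "pure_tensor A B a (b \<oplus>\<^bsub>B\<^esub> b') =
      pure_tensor A B a b \<oplus>\<^bsub>tensor_product A B\<^esub> pure_tensor A B a b'" if "b' \<in> carrier B"
    unfolding sum[OF assms assms(1) that] unfolding pure_tensor_def
    by (rule eqI) (use assms that in \<open>auto intro!: gen sum_carrier single_pair_carrier simp flip: diff_diff_add\<close>)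
  show "pure_tensor A B (c \<odot>\<^bsub>A\<^esub> a) b = c \<odot>\<^bsub>tensor_product A B\<^esub> pure_tensor A B a b"
    unfolding smult unfolding pure_tensor_def
    by (rule eqI) (use assms in \<open>auto intro!: gen single_pair_carrier\<close>)
  show "pure_tensor A B a (c \<odot>\<^bsub>B\<^esub> b) = c \<odot>\<^bsub>tensor_product A B\<^esub> pure_tensor A B a b"
    unfolding smult unfolding pure_tensor_def
    by (rule eqI) (use assms in \<open>auto intro!: gen single_pair_carrier\<close>)
qed

end

subsection \<open>Primitive elements\<close>

text \<open>Justifies the definite description: existence is the universal property of T(V) applied
  to x \<otimes> 1 + 1 \<otimes> x, and uniqueness holds because an extensional algebra morphism is
  fixed by its values on V.\<close>

lemma deshuffle:
  fixes s :: "'k::field \<Rightarrow> 'v::ab_group_add \<Rightarrow> 'v"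
  defines "T \<equiv> tensor_algebra s"
  shows "deshuffle s \<in> algebra_hom T (tensor_product T T)"
    and "deshuffle s (incl s x) = pure_tensor T T (incl s x) \<one>\<^bsub>T\<^esub> \<oplus>\<^bsub>tensor_product T T\<^esub>
      pure_tensor T T \<one>\<^bsub>T\<^esub> (incl s x)"
proof -
  let ?TT = "tensor_product T T"
  let ?d = "\<lambda>x. pure_tensor T T (incl s x) \<one>\<^bsub>T\<^esub> \<oplus>\<^bsub>?TT\<^esub> pure_tensor T T \<one>\<^bsub>T\<^esub> (incl s x)"
  have T: "k_algebra T" unfolding T_def by (rule k_algebra_tensor_algebra)
  interpret T: k_algebra T by (rule T)
  interpret TT: k_algebra ?TT by (rule k_algebra_tensor_product[OF T T])
  have incl: "incl s x \<in> carrier T" for x by (simp add: T_def)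
  note pt = pure_tensor_closed[OF T T]
  have "?d (x + y) = ?d x \<oplus>\<^bsub>?TT\<^esub> ?d y" for x y
    by (simp add: incl_add[of s, folded T_def] pure_tensor_bilinear[OF T T] incl pt TT.a_ac)
  moreover have "?d (s c x) = c \<odot>\<^bsub>?TT\<^esub> ?d x" for c x
    by (simp add: incl_scale[of s, folded T_def] pure_tensor_bilinear[OF T T] incl pt TT.smult_r_distr)
  ultimately obtain D where D: "D \<in> algebra_hom T ?TT" "\<And>x. D (incl s x) = ?d x"
    using TT.tensor_algebra_hom_exists[of ?d s] incl pt T_def by (metis TT.a_closed T.one_closed)
  define P where "P D \<longleftrightarrow> D \<in> extensional (carrier T) \<and> D \<in> algebra_hom T ?TT \<and>
    (\<forall>x. D (incl s x) = ?d x)" for D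
  have "P (restrict D (carrier T))"
    using D incl by (auto simp: P_def algebra_hom_def ring_hom_def)
  moreover have "E = E'" if "P E" "P E'" for E E'
  proof (rule extensionalityI)
    show "E \<in> extensional (carrier T)" "E' \<in> extensional (carrier T)" using that by (auto simp: P_def)
    show "E X = E' X" if "X \<in> carrier T" for X
      using tensor_algebra_hom_unique[OF TT.k_algebra_axioms, of E s E' X] \<open>P E\<close> \<open>P E'\<close> that
      by (simp add: T_def P_def)
  qed
  ultimately have "P (THE D. P D)" by (metis theI)
  moreover have "deshuffle s = (THE D. P D)"
    by (simp add: deshuffle_def P_def T_def Let_def)
  ultimately show "deshuffle s \<in> algebra_hom T ?TT" "deshuffle s (incl s x) = ?d x" by (auto simp: P_def)
qed

definition primitive :: "('k::field \<Rightarrow> 'v::ab_group_add \<Rightarrow> 'v) \<Rightarrow> ('v list \<Rightarrow>\<^sub>0 'k) set \<Rightarrow> bool" where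
  "primitive s h \<longleftrightarrow> (let T = tensor_algebra s in h \<in> carrier T \<and>
    deshuffle s h = pure_tensor T T h \<one>\<^bsub>T\<^esub> \<oplus>\<^bsub>tensor_product T T\<^esub> pure_tensor T T \<one>\<^bsub>T\<^esub> h)"

lemma primitive_closed: "primitive s h \<Longrightarrow> h \<in> carrier (tensor_algebra s)"
  by (simp add: primitive_def Let_def)

lemma primitive_incl: "primitive s (incl s x)"
  by (simp add: primitive_def deshuffle)

lemma primitive_closure:
  fixes s :: "'k::field \<Rightarrow> 'v::ab_group_add \<Rightarrow> 'v"
  defines "T \<equiv> tensor_algebra s"
  assumes "primitive s g"
  shows "primitive s h \<Longrightarrow> primitive s (g \<oplus>\<^bsub>T\<^esub> h)"
    and "primitive s (c \<odot>\<^bsub>T\<^esub> g)"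
    and "primitive s h \<Longrightarrow> primitive s (commutator T g h)"
proof -
  let ?TT = "tensor_product T T"
  have T: "k_algebra T" unfolding T_def by (rule k_algebra_tensor_algebra)
  interpret T: k_algebra T by (rule T)
  interpret TT: k_algebra ?TT by (rule k_algebra_tensor_product[OF T T])
  note homs = algebra_homD[OF deshuffle(1)[of s, folded T_def]]
  note pt = pure_tensor_closed[OF T T] and bil = pure_tensor_bilinear[OF T T]
    and mult = pure_tensor_mult[OF T T]
  have g: "g \<in> carrier T"
    "deshuffle s g = pure_tensor T T g \<one>\<^bsub>T\<^esub> \<oplus>\<^bsub>?TT\<^esub> pure_tensor T T \<one>\<^bsub>T\<^esub> g"
    using assms(2) by (simp_all add: primitive_def Let_def T_def)
  show "primitive s (c \<odot>\<^bsub>T\<^esub> g)"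
    using g by (simp add: primitive_def Let_def homs bil pt TT.smult_r_distr flip: T_def)
  assume "primitive s h"
  then have h: "h \<in> carrier T"
    "deshuffle s h = pure_tensor T T h \<one>\<^bsub>T\<^esub> \<oplus>\<^bsub>?TT\<^esub> pure_tensor T T \<one>\<^bsub>T\<^esub> h"
    by (simp_all add: primitive_def Let_def T_def)
  show "primitive s (g \<oplus>\<^bsub>T\<^esub> h)"
    using g h by (simp add: primitive_def Let_def homs bil pt TT.a_ac flip: T_def)
  have minus: "f (x \<ominus>\<^bsub>T\<^esub> y) = f x \<ominus>\<^bsub>?TT\<^esub> f y"
    if "\<And>x y. x \<in> carrier T \<Longrightarrow> y \<in> carrier T \<Longrightarrow> f (x \<oplus>\<^bsub>T\<^esub> y) = f x \<oplus>\<^bsub>?TT\<^esub> f y"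
      and "\<And>x. x \<in> carrier T \<Longrightarrow> f x \<in> carrier ?TT" and "x \<in> carrier T" "y \<in> carrier T" for f x y
  proof -
    have "f x = f (x \<ominus>\<^bsub>T\<^esub> y) \<oplus>\<^bsub>?TT\<^esub> f y"
      using that(1)[of "x \<ominus>\<^bsub>T\<^esub> y" y] that(3,4) by (simp add: T.minus_eq T.a_assoc T.l_neg)
    then show ?thesis
      using that(2)[of "x \<ominus>\<^bsub>T\<^esub> y"] that(2)[of y] that(3,4)
      by (simp add: TT.minus_eq TT.a_assoc TT.r_neg)
  qed
  let ?l = "\<lambda>x. pure_tensor T T x \<one>\<^bsub>T\<^esub>" and ?r = "\<lambda>x. pure_tensor T T \<one>\<^bsub>T\<^esub> x"
  have m: "?l (x \<ominus>\<^bsub>T\<^esub> y) = ?l x \<ominus>\<^bsub>?TT\<^esub> ?l y" "?r (x \<ominus>\<^bsub>T\<^esub> y) = ?r x \<ominus>\<^bsub>?TT\<^esub> ?r y"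
    "deshuffle s (x \<ominus>\<^bsub>T\<^esub> y) = deshuffle s x \<ominus>\<^bsub>?TT\<^esub> deshuffle s y"
    if "x \<in> carrier T" "y \<in> carrier T" for x y
    by (rule minus; simp add: that homs bil pt)+
  \<comment> \<open>The last two equations are the point: elements of the left and of the right
    tensor factor commute, so the mixed terms of the commutator cancel.\<close>
  have gh: "?l (g \<otimes>\<^bsub>T\<^esub> h) = ?l g \<otimes>\<^bsub>?TT\<^esub> ?l h" "?l (h \<otimes>\<^bsub>T\<^esub> g) = ?l h \<otimes>\<^bsub>?TT\<^esub> ?l g"
    "?r (g \<otimes>\<^bsub>T\<^esub> h) = ?r g \<otimes>\<^bsub>?TT\<^esub> ?r h" "?r (h \<otimes>\<^bsub>T\<^esub> g) = ?r h \<otimes>\<^bsub>?TT\<^esub> ?r g"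
    "?r g \<otimes>\<^bsub>?TT\<^esub> ?l h = ?l h \<otimes>\<^bsub>?TT\<^esub> ?r g" "?r h \<otimes>\<^bsub>?TT\<^esub> ?l g = ?l g \<otimes>\<^bsub>?TT\<^esub> ?r h"
    using g h by (simp_all add: mult)
  have "deshuffle s (commutator T g h) =
      (?l g \<oplus>\<^bsub>?TT\<^esub> ?r g) \<otimes>\<^bsub>?TT\<^esub> (?l h \<oplus>\<^bsub>?TT\<^esub> ?r h) \<ominus>\<^bsub>?TT\<^esub>
      (?l h \<oplus>\<^bsub>?TT\<^esub> ?r h) \<otimes>\<^bsub>?TT\<^esub> (?l g \<oplus>\<^bsub>?TT\<^esub> ?r g)"
    using g h by (simp add: commutator_def m homs)
  also have "\<dots> = ?l g \<otimes>\<^bsub>?TT\<^esub> ?l h \<oplus>\<^bsub>?TT\<^esub> ?l g \<otimes>\<^bsub>?TT\<^esub> ?r h \<oplus>\<^bsub>?TT\<^esub>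
      (?r g \<otimes>\<^bsub>?TT\<^esub> ?l h \<oplus>\<^bsub>?TT\<^esub> ?r g \<otimes>\<^bsub>?TT\<^esub> ?r h) \<ominus>\<^bsub>?TT\<^esub>
      (?l h \<otimes>\<^bsub>?TT\<^esub> ?l g \<oplus>\<^bsub>?TT\<^esub> ?l h \<otimes>\<^bsub>?TT\<^esub> ?r g \<oplus>\<^bsub>?TT\<^esub>
      (?r h \<otimes>\<^bsub>?TT\<^esub> ?l g \<oplus>\<^bsub>?TT\<^esub> ?r h \<otimes>\<^bsub>?TT\<^esub> ?r g))"
    using g h pt by (simp add: TT.l_distr TT.r_distr TT.a_ac)
  also have "\<dots> = (?l g \<otimes>\<^bsub>?TT\<^esub> ?l h \<ominus>\<^bsub>?TT\<^esub> ?l h \<otimes>\<^bsub>?TT\<^esub> ?l g) \<oplus>\<^bsub>?TT\<^esub>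
      (?r g \<otimes>\<^bsub>?TT\<^esub> ?r h \<ominus>\<^bsub>?TT\<^esub> ?r h \<otimes>\<^bsub>?TT\<^esub> ?r g)"
    unfolding gh(5,6) using g(1) h(1) pt[OF g(1) T.one_closed] pt[OF T.one_closed g(1)]
      pt[OF h(1) T.one_closed] pt[OF T.one_closed h(1)] by algebra
  also have "\<dots> = ?l (commutator T g h) \<oplus>\<^bsub>?TT\<^esub> ?r (commutator T g h)"
    using g h by (simp add: commutator_def m gh(1-4))
  finally show "primitive s (commutator T g h)"
    using g h by (simp add: primitive_def Let_def commutator_def flip: T_def)
qed

subsection \<open>The extended product\<close>

locale extended_product_tensor = k_algebra T
  for T :: "('k::field, ('v::ab_group_add list \<Rightarrow>\<^sub>0 'k) set) module" (structure) +
  fixes s :: "'k \<Rightarrow> 'v \<Rightarrow> 'v" and ast :: "'v \<Rightarrow> 'v \<Rightarrow> 'v"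
    and astT :: "('v list \<Rightarrow>\<^sub>0 'k) set \<Rightarrow> ('v list \<Rightarrow>\<^sub>0 'k) set \<Rightarrow> ('v list \<Rightarrow>\<^sub>0 'k) set" (infixl "\<star>" 75)
  assumes T: "T = tensor_algebra s"
    and extended: "extended_product s ast (\<star>)"
begin

abbreviation bracket ("[_, _]\<^sub>T") where "[f, g]\<^sub>T \<equiv> commutator T f g"

lemma incl_carrier [simp]: "incl s x \<in> carrier T"
  by (simp add: T)

lemma bilinear_star: "bilinear_on T (\<star>)"
  using extended by (simp add: extended_product_def Let_def flip: T)

lemma star_closed [simp]: "f \<in> carrier T \<Longrightarrow> g \<in> carrier T \<Longrightarrow> f \<star> g \<in> carrier T"
  and star_add_left: "f \<in> carrier T \<Longrightarrow> g \<in> carrier T \<Longrightarrow> h \<in> carrier T \<Longrightarrow> (f \<oplus> g) \<star> h = f \<star> h \<oplus> g \<star> h"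
  and star_add_right: "f \<in> carrier T \<Longrightarrow> g \<in> carrier T \<Longrightarrow> h \<in> carrier T \<Longrightarrow> f \<star> (g \<oplus> h) = f \<star> g \<oplus> f \<star> h"
  and star_smult_left: "f \<in> carrier T \<Longrightarrow> g \<in> carrier T \<Longrightarrow> (c \<odot> f) \<star> g = c \<odot> (f \<star> g)"
  and star_smult_right: "f \<in> carrier T \<Longrightarrow> g \<in> carrier T \<Longrightarrow> f \<star> (c \<odot> g) = c \<odot> (f \<star> g)"
  using bilinear_star by (simp_all add: bilinear_on_def)

lemma star_incl: "incl s x \<star> incl s y = incl s (ast x y)"
  and star_one: "f \<in> carrier T \<Longrightarrow> f \<star> \<one> = f"
  and star_mult_incl: "f \<in> carrier T \<Longrightarrow>
    incl s x \<star> (f \<otimes> incl s y) = (incl s x \<star> f) \<star> incl s y \<ominus> incl s x \<star> (f \<star> incl s y)"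
  using extended by (simp_all add: extended_product_def Let_def flip: T)

text \<open>The Sweedler clause holds for every representative of the coproduct, in particular for
  the two-term sum (h, 1) + (1, h). Additivity of \<open>combination\<close> evaluates it without
  asking whether the two pairs differ.\<close>

lemma mult_star:
  assumes h: "primitive s h" and f: "f \<in> carrier T" and g: "g \<in> carrier T"
  shows "(f \<otimes> g) \<star> h = (f \<star> h) \<otimes> g \<oplus> f \<otimes> (g \<star> h)"
proof -
  let ?M = "monoid_algebra (T \<times>\<times> T) :: ('k, _) module"
  let ?p = "Poly_Mapping.single (h, \<one>) 1 :: _ \<Rightarrow>\<^sub>0 'k" and ?q = "Poly_Mapping.single (\<one>, h) 1 :: _ \<Rightarrow>\<^sub>0 'k"
  let ?g = "\<lambda>(a, b). (f \<star> a) \<otimes> (g \<star> b)"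
  have hc: "h \<in> carrier T" using h primitive_closed T by blast
  have kT: "k_algebra T" by (rule k_algebra_axioms)
  interpret M: k_algebra ?M by (rule k_algebra_monoid_algebra[OF monoid_pairs[OF kT kT]])
  note I = ideal_bilinearity_ideal[OF kT kT]
  interpret I: ideal "bilinearity_ideal T T" ?M by (rule I)
  have c: "?p \<in> carrier ?M" "?q \<in> carrier ?M"
    using hc by (simp_all add: single_pair_carrier[OF kT kT])
  have "deshuffle s h = bilinearity_ideal T T +>\<^bsub>?M\<^esub> (?p \<oplus>\<^bsub>?M\<^esub> ?q)"
    using h M.quotient_algebra_ops(1)[OF I c]
    by (simp add: primitive_def Let_def pure_tensor_def tensor_product_def flip: T)
  then have "?p + ?q \<in> deshuffle s h"
    using I.a_rcos_self[OF M.a_closed[OF c]] by (simp add: monoid_algebra_simps(4))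
  moreover have "\<forall>f\<in>carrier T. \<forall>g\<in>carrier T. \<forall>h\<in>carrier T. \<forall>p\<in>deshuffle s h. (f \<otimes> g) \<star> h =
      finsum T (\<lambda>(a, b). Poly_Mapping.lookup p (a, b) \<odot> ((f \<star> a) \<otimes> (g \<star> b))) (Poly_Mapping.keys p)"
    using extended by (simp add: extended_product_def Let_def flip: T)
  ultimately have "(f \<otimes> g) \<star> h = combination ?g (?p + ?q)"
    using f g hc unfolding combination_def by (simp add: case_prod_unfold)
  also have "\<dots> = combination ?g ?p \<oplus> combination ?g ?q"
    using f g hc by (intro combination_add) auto
  finally show ?thesis using f g hc by (simp add: star_one)
qed

lemma additive_minus:
  assumes add: "\<And>x y. x \<in> carrier T \<Longrightarrow> y \<in> carrier T \<Longrightarrow> f (x \<oplus> y) = f x \<oplus> f y"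
    and closed: "\<And>x. x \<in> carrier T \<Longrightarrow> f x \<in> carrier T" and xy: "x \<in> carrier T" "y \<in> carrier T"
  shows "f (x \<ominus> y) = f x \<ominus> f y"
proof -
  have "f x = f (x \<ominus> y) \<oplus> f y"
    using add[of "x \<ominus> y" y] xy by (simp add: minus_eq a_assoc l_neg)
  then show ?thesis
    using closed[of "x \<ominus> y"] closed[of y] xy by (simp add: minus_eq a_assoc r_neg)
qed

lemma star_minus_left:
  "f \<in> carrier T \<Longrightarrow> g \<in> carrier T \<Longrightarrow> h \<in> carrier T \<Longrightarrow> (f \<ominus> g) \<star> h = f \<star> h \<ominus> g \<star> h"
  by (rule additive_minus) (simp_all add: star_add_left)

lemma star_minus_right:
  "f \<in> carrier T \<Longrightarrow> g \<in> carrier T \<Longrightarrow> h \<in> carrier T \<Longrightarrow> f \<star> (g \<ominus> h) = f \<star> g \<ominus> f \<star> h"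
  by (rule additive_minus) (simp_all add: star_add_right)

lemma zero_star: "h \<in> carrier T \<Longrightarrow> \<zero> \<star> h = \<zero>"
  using star_smult_left[of \<zero> h 0] by simp

text \<open>A derivation kills the unit: 1 = 1 1 gives 1 * h = 1 * h + 1 * h.\<close>

lemma one_star:
  assumes "primitive s h"
  shows "\<one> \<star> h = \<zero>"
proof -
  have h: "h \<in> carrier T" using assms primitive_closed T by blast
  then have "\<one> \<star> h = \<one> \<star> h \<oplus> \<one> \<star> h"
    using mult_star[OF assms one_closed one_closed] by simp
  then show ?thesis using h by (metis add.l_cancel_one one_closed star_closed)
qed

section \<open>Left-normed brackets and the Lie algebra generated by V\<close>

lemma bracket_closed [simp]: "f \<in> carrier T \<Longrightarrow> g \<in> carrier T \<Longrightarrow> [f, g]\<^sub>T \<in> carrier T"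
  by (simp add: commutator_def)

lemma bracket_star:
  assumes "primitive s h" "f \<in> carrier T" "g \<in> carrier T"
  shows "[f, g]\<^sub>T \<star> h = [f \<star> h, g]\<^sub>T \<oplus> [f, g \<star> h]\<^sub>T"
proof -
  have h: "h \<in> carrier T" using assms(1) primitive_closed T by blast
  note c = assms(2,3) star_closed[OF assms(2) h] star_closed[OF assms(3) h]
  show ?thesis
    unfolding commutator_def star_minus_left[OF m_closed m_closed h, OF assms(2,3,3,2)]
      mult_star[OF assms(1,2,3)] mult_star[OF assms(1,3,2)]
    using c by algebra
qed

text \<open>An induction principle for Lie(V) in which brackets grow by one letter on the right, the
  only place where the axiom for x * (f y) applies.\<close>

inductive_set left_normed :: "('v list \<Rightarrow>\<^sub>0 'k) set set" where
  left_normed_incl: "incl s x \<in> left_normed"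
| left_normed_add: "f \<in> left_normed \<Longrightarrow> g \<in> left_normed \<Longrightarrow> f \<oplus> g \<in> left_normed"
| left_normed_smult: "f \<in> left_normed \<Longrightarrow> c \<odot> f \<in> left_normed"
| left_normed_bracket: "g \<in> left_normed \<Longrightarrow> [g, incl s y]\<^sub>T \<in> left_normed"

lemma left_normed_primitive: "h \<in> left_normed \<Longrightarrow> primitive s h"
  by (induction rule: left_normed.induct)
    (simp_all add: primitive_incl primitive_closure[of s, folded T])

lemma left_normed_closed [simp]: "h \<in> left_normed \<Longrightarrow> h \<in> carrier T"
  using left_normed_primitive primitive_closed T by blast

lemma left_normed_zero: "\<zero> \<in> left_normed"
  using left_normed_smult[OF left_normed_incl, of 0] by simp

lemma left_normed_minus: "f \<in> left_normed \<Longrightarrow> g \<in> left_normed \<Longrightarrow> f \<ominus> g \<in> left_normed"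
proof -
  assume f: "f \<in> left_normed" and g: "g \<in> left_normed"
  have "(- 1) \<odot> g \<oplus> g = \<zero>"
    using smult_l_distr[of g "- 1" 1] g by simp
  then have "\<ominus> g = (- 1) \<odot> g" using g by (intro minus_equality) simp_all
  then show ?thesis using f g by (simp add: minus_eq left_normed_add left_normed_smult)
qed

lemma bracket_left_normed: "g \<in> left_normed \<Longrightarrow> f \<in> left_normed \<Longrightarrow> [f, g]\<^sub>T \<in> left_normed"
proof (induction g arbitrary: f rule: left_normed.induct)
  case (left_normed_incl x)
  then show ?case by (rule left_normed.left_normed_bracket)
next
  case (left_normed_add g h)
  have "[f, g \<oplus> h]\<^sub>T = [f, g]\<^sub>T \<oplus> [f, h]\<^sub>T"
    unfolding commutator_def
    using left_normed_closed[OF left_normed_add.hyps(1)] left_normed_closed[OF left_normed_add.hyps(2)]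
      left_normed_closed[OF left_normed_add.prems] by algebra
  then show ?case using left_normed_add by (simp add: left_normed.left_normed_add)
next
  case (left_normed_smult g c)
  have "[f, c \<odot> g]\<^sub>T = c \<odot> (f \<otimes> g) \<ominus> c \<odot> (g \<otimes> f)"
    using left_normed_smult by (simp add: commutator_def smult_mult_left smult_mult_right)
  also have "\<dots> = c \<odot> [f, g]\<^sub>T"
    unfolding commutator_def using left_normed_smult
    by (intro additive_minus[symmetric]) (simp_all add: smult_r_distr)
  finally show ?case using left_normed_smult by (simp add: left_normed.left_normed_smult)
next
  case (left_normed_bracket g y)
  \<comment> \<open>Jacobi moves the inner bracket to the left. Both terms are then covered: the
    induction hypothesis for g is used with f and with [f, y].\<close>
  have "[f, [g, incl s y]\<^sub>T]\<^sub>T = [[f, g]\<^sub>T, incl s y]\<^sub>T \<ominus> [[f, incl s y]\<^sub>T, g]\<^sub>T"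
    unfolding commutator_def
    using left_normed_closed[OF left_normed_bracket.hyps] left_normed_closed[OF left_normed_bracket.prems]
      incl_carrier[of y] by algebra
  then show ?case
    using left_normed_bracket by (simp add: left_normed_minus left_normed.left_normed_bracket)
qed

lemma carrier_free_lie: "carrier (free_lie s) = left_normed"
proof -
  have "lie_subalgebra T left_normed"
    unfolding lie_subalgebra_def
    using left_normed_zero left_normed_add left_normed_smult bracket_left_normed by auto
  moreover have "left_normed \<subseteq> W" if W: "lie_subalgebra T W" "range (incl s) \<subseteq> W" for W
  proof
    have "incl s x \<in> W" for x using W by blast
    fix h assume "h \<in> left_normed"
    then show "h \<in> W"
      by (induction rule: left_normed.induct) (use W \<open>\<And>x. incl s x \<in> W\<close> in \<open>auto simp: lie_subalgebra_def\<close>)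
  qed
  ultimately have "\<Inter>{W. lie_subalgebra T W \<and> range (incl s) \<subseteq> W} = left_normed"
    using left_normed_incl by (intro equalityI Inter_lower Inter_greatest) auto
  then show ?thesis by (simp add: free_lie_def T)
qed

text \<open>Multiplying by a letter z on the right is a derivation that sends letters to
  letters.\<close>

lemma left_normed_star_incl: "h \<in> left_normed \<Longrightarrow> h \<star> incl s z \<in> left_normed"
proof (induction rule: left_normed.induct)
  case (left_normed_bracket g y)
  then show ?case
    using left_normed.left_normed_bracket[OF left_normed_bracket.hyps, of "ast y z"]
    by (simp add: bracket_star primitive_incl star_incl left_normed.left_normed_bracket
        left_normed.left_normed_add)
qed (simp_all add: star_incl star_add_left star_smult_left left_normed.intros)

end

subsection \<open>Morphisms to a post-Lie algebra\<close>

lemma (in vector_space) linear_extension_free_mult: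
  "linear_extension scale g (p \<otimes>\<^bsub>free_algebra\<^esub> q) =
    linear_extension scale (\<lambda>a. linear_extension scale (\<lambda>b. g (a @ b)) q) p"
proof -
  have "Poly_Mapping.keys p \<subseteq> UNIV" by simp
  then show ?thesis
  proof (induction p rule: poly_mapping_additive_induct)
    case (single v c)
    have "Poly_Mapping.keys q \<subseteq> UNIV" by simp
    then show ?case
      by (induction q rule: poly_mapping_additive_induct)
        (simp_all add: free_algebra_simps free_algebra_mult_bilinear linear_extension_add scale_right_distrib)
  qed (simp_all add: free_algebra_mult_bilinear linear_extension_add)
qed

lemma (in vector_space) linear_extension_free_mult':
  "linear_extension scale g (p \<otimes>\<^bsub>free_algebra\<^esub> q) =
    linear_extension scale (\<lambda>b. linear_extension scale (\<lambda>a. g (a @ b)) p) q"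
  unfolding linear_extension_free_mult by (rule linear_extension_commute)

lemma (in magmatic_algebra) prod_simps:
  "prod (x + y) z = prod x z + prod y z" "prod x (y + z) = prod x y + prod x z"
  "prod (x - y) z = prod x z - prod y z" "prod x (y - z) = prod x y - prod x z"
  "prod (scale c x) y = scale c (prod x y)" "prod x (scale c y) = scale c (prod x y)"
proof -
  interpret l: Vector_Spaces.linear scale scale "prod w" for w
    using bilinear_prod unfolding bilinear_product_def by blast
  interpret r: Vector_Spaces.linear scale scale "\<lambda>x. prod x w" for w
    using bilinear_prod unfolding bilinear_product_def by blast
  show "prod (x + y) z = prod x z + prod y z" "prod x (y + z) = prod x y + prod x z"
    "prod (x - y) z = prod x z - prod y z" "prod x (y - z) = prod x y - prod x z"
    "prod (scale c x) y = scale c (prod x y)" "prod x (scale c y) = scale c (prod x y)"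
    by (simp_all add: l.add r.add l.diff r.diff l.scale r.scale)
qed

locale post_lie_target = extended_product_tensor T s ast astT + L: post_lie_algebra scaleL br starL
  for T :: "('k::field, ('v::ab_group_add list \<Rightarrow>\<^sub>0 'k) set) module" (structure)
    and s :: "'k \<Rightarrow> 'v \<Rightarrow> 'v" and ast :: "'v \<Rightarrow> 'v \<Rightarrow> 'v"
    and astT :: "('v list \<Rightarrow>\<^sub>0 'k) set \<Rightarrow> ('v list \<Rightarrow>\<^sub>0 'k) set \<Rightarrow> ('v list \<Rightarrow>\<^sub>0 'k) set" (infixl "\<star>" 75)
    and scaleL :: "'k \<Rightarrow> 'l::ab_group_add \<Rightarrow> 'l" and br starL :: "'l \<Rightarrow> 'l \<Rightarrow> 'l" +
  fixes \<phi> :: "'v \<Rightarrow> 'l"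
  assumes linear_\<phi>: "Vector_Spaces.linear s scaleL \<phi>"
    and \<phi>_ast: "\<phi> (ast x y) = starL (\<phi> x) (\<phi> y)"
begin

sublocale \<phi>: Vector_Spaces.linear s scaleL \<phi> by (rule linear_\<phi>)

lemma incl_minus: "incl s (x - y) = incl s x \<ominus> incl s y"
proof -
  have "incl s x = incl s (x - y) \<oplus> incl s y"
    using incl_add[of s "x - y" y] by (simp add: T)
  then show ?thesis by (simp add: minus_eq a_assoc r_neg)
qed

text \<open>An element \<open>X\<close> of \<open>T(V)\<close> represents \<open>l\<close> if it is sent to \<open>l\<close> in the enveloping algebra of \<open>L\<close>;
  this is tested by the functionals \<open>\<sigma> (u _ v)\<close>, since \<open>\<sigma>\<close> vanishes on its defining relations.\<close>

lemma lie_extension_exists: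
  obtains F where
    "\<And>X Y. X \<in> left_normed \<Longrightarrow> Y \<in> left_normed \<Longrightarrow> F (X \<oplus> Y) = F X + F Y"
    "\<And>c X. X \<in> left_normed \<Longrightarrow> F (c \<odot> X) = scaleL c (F X)"
    "\<And>X Y. X \<in> left_normed \<Longrightarrow> Y \<in> left_normed \<Longrightarrow> F [X, Y]\<^sub>T = br (F X) (F Y)"
    "\<And>x. F (incl s x) = \<phi> x"
proof -
  obtain \<sigma> :: "'l list \<Rightarrow> 'l" where
    lin: "\<And>u v. Vector_Spaces.linear scaleL scaleL (\<lambda>x. \<sigma> (u @ x # v))" and
    rel: "\<And>u x y v. \<sigma> (u @ x # y # v) - \<sigma> (u @ y # x # v) = \<sigma> (u @ br x y # v)" and
    one: "\<And>x. \<sigma> [x] = x"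
    by (rule pbw_projection[OF L.lie_algebra_axioms]) blast
  interpret \<sigma>: Vector_Spaces.linear scaleL scaleL "\<lambda>x. \<sigma> (u @ x # v)" for u v by (rule lin)
  define test where "test u v p = linear_extension scaleL (\<lambda>w. \<sigma> (u @ map \<phi> w @ v)) p" for u v p
  note test_simps = L.linear_extension_add L.linear_extension_minus L.linear_extension_single
    L.linear_extension_scalar_mult
  have test_mult: "test u v (p \<otimes>\<^bsub>free_algebra\<^esub> q) =
      linear_extension scaleL (\<lambda>a. test (u @ map \<phi> a) v q) p"
    "test u v (p \<otimes>\<^bsub>free_algebra\<^esub> q) = linear_extension scaleL (\<lambda>b. test u (map \<phi> b @ v) p) q" for u v p q
    unfolding test_def
     apply (simp add: L.linear_extension_free_mult)
    apply (simp add: L.linear_extension_free_mult')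
    done
  \<comment> \<open>The contexts \<open>u\<close> and \<open>v\<close> make the common kernel an
    ideal: multiplying p by a word on either side only lengthens a context.\<close>
  define K where "K = {p. \<forall>u v. test u v p = 0}"
  have "ideal K free_algebra"
  proof (rule idealI)
    show "ring (free_algebra :: ('k, 'v list \<Rightarrow>\<^sub>0 'k) module)" by (rule free_algebra.ring_axioms)
    show "subgroup K (add_monoid free_algebra)"
    proof (rule free_algebra.add.subgroupI)
      have "0 \<in> K" by (simp add: K_def test_def)
      then show "K \<noteq> {}" by blast
      show "\<ominus>\<^bsub>free_algebra\<^esub> p \<in> K" if "p \<in> K" for p
      proof -
        have "\<ominus>\<^bsub>free_algebra\<^esub> p = \<zero>\<^bsub>free_algebra\<^esub> \<ominus>\<^bsub>free_algebra\<^esub> p"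
          by (simp add: free_algebra.minus_eq free_algebra_simps(1))
        also have "\<dots> = 0 - p" by (simp only: free_algebra_simps(3,6))
        finally have "\<ominus>\<^bsub>free_algebra\<^esub> p = 0 - p" .
        then show ?thesis using that L.linear_extension_minus[of _ 0 p] by (simp add: K_def test_def)
      qed
    qed (auto simp: K_def test_def free_algebra_simps L.linear_extension_add)
    show "x \<otimes>\<^bsub>free_algebra\<^esub> p \<in> K" "p \<otimes>\<^bsub>free_algebra\<^esub> x \<in> K" if "p \<in> K" for p x
      using that test_mult(1)[of _ _ x p] test_mult(2)[of _ _ p x] by (simp_all add: K_def)
  qed
  then have "linearity_ideal s \<subseteq> K"
    unfolding linearity_ideal_def
  proof (rule free_algebra.genideal_minimal)
    have "test u v (Poly_Mapping.single [x + y] 1 - Poly_Mapping.single [x] 1 - Poly_Mapping.single [y] 1) = 0"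
      "test u v (Poly_Mapping.single [s c x] 1 - Poly_Mapping.single [x] c) = 0" for u v x y c
      by (simp_all add: test_def test_simps \<phi>.add \<phi>.scale \<sigma>.add \<sigma>.scale)
    then show "{Poly_Mapping.single [x + y] 1 - Poly_Mapping.single [x] 1 - Poly_Mapping.single [y] 1 | x y. True} \<union>
        {Poly_Mapping.single [s c x] 1 - Poly_Mapping.single [x] c | c x. True} \<subseteq> K"
      unfolding K_def by blast
  qed
  then have test_cong: "test u v p = test u v q" if "tensor_class s p = tensor_class s q" for u v p q
    using that unfolding tensor_class_eq_iff K_def test_def
    by (auto simp: L.linear_extension_minus dest!: subsetD)
  define represents where
    "represents X l \<longleftrightarrow> (\<exists>p. X = tensor_class s p \<and> (\<forall>u v. test u v p = \<sigma> (u @ l # v)))" for X l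
  \<comment> \<open>Empty contexts give \<open>\<sigma>\<close> \<open>[l]\<close>, which is l. All
    other contexts are there for the bracket.\<close>
  have unique: "l = l'" if X: "represents X l" "represents X l'" for X l l'
  proof -
    obtain p q where "tensor_class s p = tensor_class s q" "test [] [] p = l" "test [] [] q = l'"
      using X unfolding represents_def by (metis append_Nil one)
    then show ?thesis using test_cong by metis
  qed
  have add: "represents (X \<oplus> Y) (l + l')" if X: "represents X l" and Y: "represents Y l'" for X Y l l'
  proof -
    obtain p where p: "X = tensor_class s p" "\<And>u v. test u v p = \<sigma> (u @ l # v)"
      using X unfolding represents_def by blast
    obtain q where q: "Y = tensor_class s q" "\<And>u v. test u v q = \<sigma> (u @ l' # v)"
      using Y unfolding represents_def by blast
    have "test u v (p + q) = \<sigma> (u @ (l + l') # v)" for u v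
      using p(2) q(2) by (simp add: test_def L.linear_extension_add \<sigma>.add)
    moreover have "X \<oplus> Y = tensor_class s (p + q)"
      using p(1) q(1) by (simp add: T tensor_class_simps)
    ultimately show ?thesis unfolding represents_def by blast
  qed
  have smult: "represents (c \<odot> X) (scaleL c l)" if X: "represents X l" for X l c
  proof -
    obtain p where p: "X = tensor_class s p" "\<And>u v. test u v p = \<sigma> (u @ l # v)"
      using X unfolding represents_def by blast
    have "test u v (scalar_mult c p) = \<sigma> (u @ scaleL c l # v)" for u v
      using p(2) by (simp add: test_def L.linear_extension_scalar_mult \<sigma>.scale)
    moreover have "c \<odot> X = tensor_class s (scalar_mult c p)"
      using p(1) by (simp add: T tensor_class_simps)
    ultimately show ?thesis unfolding represents_def by blast
  qed
  \<comment> \<open>In a product the second factor is tested first, in the context enlarged by the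
    first; it may then be replaced by the single letter l', which becomes part of the context of the
    first factor. The relation of \<open>\<sigma>\<close> turns l l' - l' l into the
    bracket.\<close>
  have bracket: "represents [X, Y]\<^sub>T (br l l')" if X: "represents X l" and Y: "represents Y l'" for X Y l l'
  proof -
    obtain p where p: "X = tensor_class s p" "\<And>u v. test u v p = \<sigma> (u @ l # v)"
      using X unfolding represents_def by blast
    obtain q where q: "Y = tensor_class s q" "\<And>u v. test u v q = \<sigma> (u @ l' # v)"
      using Y unfolding represents_def by blast
    have pq: "test u v (p \<otimes>\<^bsub>free_algebra\<^esub> q) = \<sigma> (u @ l # l' # v)" for u v
    proof -
      have "test u v (p \<otimes>\<^bsub>free_algebra\<^esub> q) = test u (l' # v) p"
        by (simp add: test_mult(1) q(2)) (simp add: test_def)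
      then show ?thesis by (simp add: p(2))
    qed
    have qp: "test u v (q \<otimes>\<^bsub>free_algebra\<^esub> p) = \<sigma> (u @ l' # l # v)" for u v
    proof -
      have "test u v (q \<otimes>\<^bsub>free_algebra\<^esub> p) = test u (l # v) q"
        by (simp add: test_mult(1) p(2)) (simp add: test_def)
      then show ?thesis by (simp add: q(2))
    qed
    let ?r = "p \<otimes>\<^bsub>free_algebra\<^esub> q - q \<otimes>\<^bsub>free_algebra\<^esub> p"
    have "test u v ?r = \<sigma> (u @ br l l' # v)" for u v
      using pq[of u v] qp[of u v] rel[of u l l' v] by (simp add: test_def L.linear_extension_minus)
    then have r: "represents (tensor_class s ?r) (br l l')" unfolding represents_def by blast
    have "X \<otimes> Y = tensor_class s ?r \<oplus> Y \<otimes> X"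
      using p(1) q(1) by (simp add: T tensor_class_simps)
    moreover have "X \<in> carrier T" "Y \<in> carrier T" "tensor_class s ?r \<in> carrier T"
      using p(1) q(1) by (simp_all add: T tensor_class_simps)
    ultimately have "[X, Y]\<^sub>T = tensor_class s ?r"
      by (simp add: commutator_def minus_eq a_assoc r_neg)
    then show ?thesis using r by simp
  qed
  have incl: "represents (incl s x) (\<phi> x)" for x
    unfolding represents_def incl_eq by (auto simp: test_def)
  define F where "F X = (SOME l. represents X l)" for X
  have F: "F X = l" if "represents X l" for X l
    unfolding F_def using that unique by (metis someI)
  have "\<exists>l. represents X l" if "X \<in> left_normed" for X
    using that by (induction rule: left_normed.induct) (blast intro: incl add smult bracket)+
  then have rep: "represents X (F X)" if "X \<in> left_normed" for X
    using that F by blast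
  show thesis
    by (rule that[of F]) (rule F; blast intro: incl add smult bracket rep)+
qed

text \<open>The induction claim on h. The first clause is the morphism property against letters,
  strengthened by x * h lying in V; the second is the axiom \<open>star_mult_incl\<close> with h in
  place of a letter. They are proved together: the bracket step for the first uses the
  second.\<close>

definition adapted :: "(('v list \<Rightarrow>\<^sub>0 'k) set \<Rightarrow> 'l) \<Rightarrow> ('v list \<Rightarrow>\<^sub>0 'k) set \<Rightarrow> bool" where
  "adapted F h \<longleftrightarrow> h \<in> left_normed \<and>
    (\<forall>x. \<exists>y. incl s x \<star> h = incl s y \<and> \<phi> y = starL (\<phi> x) (F h)) \<and>
    (\<forall>x. \<forall>k\<in>carrier T. incl s x \<star> (k \<otimes> h) = (incl s x \<star> k) \<star> h \<ominus> incl s x \<star> (k \<star> h))"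

section \<open>Compatibility of the Lie morphism with the second product\<close>

context
  fixes F
  assumes F_add: "\<And>X Y. X \<in> left_normed \<Longrightarrow> Y \<in> left_normed \<Longrightarrow> F (X \<oplus> Y) = F X + F Y"
    and F_smult: "\<And>c X. X \<in> left_normed \<Longrightarrow> F (c \<odot> X) = scaleL c (F X)"
    and F_bracket: "\<And>X Y. X \<in> left_normed \<Longrightarrow> Y \<in> left_normed \<Longrightarrow> F [X, Y]\<^sub>T = br (F X) (F Y)"
    and F_incl: "\<And>x. F (incl s x) = \<phi> x"
begin

text \<open>Both f \<mapsto> f * h and l \<mapsto> \<open>starL l (F h)\<close> are derivations of
  the brackets, so agreement on letters, the first clause of \<open>adapted\<close>, spreads to all
  left-normed f.\<close>

lemma star_adapted:
  assumes h: "adapted F h" and f: "f \<in> left_normed"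
  shows "f \<star> h \<in> left_normed \<and> F (f \<star> h) = starL (F f) (F h)"
  using f
proof (induction rule: left_normed.induct)
  case (left_normed_incl x)
  then show ?case using h unfolding adapted_def by (metis F_incl left_normed.left_normed_incl)
next
  case (left_normed_add f g)
  then show ?case
    using h by (simp add: adapted_def star_add_left F_add L.prod_simps left_normed.left_normed_add)
next
  case (left_normed_smult f c)
  then show ?case
    using h by (simp add: adapted_def star_smult_left F_smult L.prod_simps left_normed.left_normed_smult)
next
  case (left_normed_bracket g y)
  have "primitive s h" using h by (simp add: adapted_def left_normed_primitive)
  moreover obtain z where z: "incl s y \<star> h = incl s z" "\<phi> z = starL (\<phi> y) (F h)"
    using h unfolding adapted_def by blast
  ultimately have "[g, incl s y]\<^sub>T \<star> h = [g \<star> h, incl s y]\<^sub>T \<oplus> [g, incl s z]\<^sub>T"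
    using left_normed_bracket by (simp add: bracket_star)
  then show ?case
    using left_normed_bracket z
    by (simp add: F_add F_bracket F_incl L.br_star left_normed.intros)
qed

lemma adapted_incl: "adapted F (incl s y)"
  unfolding adapted_def
  by (auto simp: F_incl left_normed_incl star_incl star_mult_incl \<phi>_ast intro!: exI)

lemma adapted_add:
  assumes "adapted F g" "adapted F h"
  shows "adapted F (g \<oplus> h)"
proof -
  have gh: "g \<in> left_normed" "h \<in> left_normed" using assms by (simp_all add: adapted_def)
  have "\<exists>y. incl s x \<star> (g \<oplus> h) = incl s y \<and> \<phi> y = starL (\<phi> x) (F (g \<oplus> h))" for x
  proof -
    obtain y z where "incl s x \<star> g = incl s y" "\<phi> y = starL (\<phi> x) (F g)"
      "incl s x \<star> h = incl s z" "\<phi> z = starL (\<phi> x) (F h)"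
      using assms unfolding adapted_def by blast
    then show ?thesis
      using gh by (intro exI[of _ "y + z"])
        (simp add: star_add_right F_add \<phi>.add L.prod_simps incl_add flip: T)
  qed
  moreover have "incl s x \<star> (k \<otimes> (g \<oplus> h)) = (incl s x \<star> k) \<star> (g \<oplus> h) \<ominus> incl s x \<star> (k \<star> (g \<oplus> h))"
    if k: "k \<in> carrier T" for x k
  proof -
    note c = k left_normed_closed[OF gh(1)] left_normed_closed[OF gh(2)] incl_carrier[of x]
    have "incl s x \<star> (k \<otimes> (g \<oplus> h)) =
      ((incl s x \<star> k) \<star> g \<ominus> incl s x \<star> (k \<star> g)) \<oplus> ((incl s x \<star> k) \<star> h \<ominus> incl s x \<star> (k \<star> h))"
      using assms c by (simp add: adapted_def r_distr star_add_right)
    also have "\<dots> = (incl s x \<star> k) \<star> g \<oplus> (incl s x \<star> k) \<star> h \<ominus> (incl s x \<star> (k \<star> g) \<oplus> incl s x \<star> (k \<star> h))"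
      using c star_closed[OF star_closed[OF c(4,1)] c(2)] star_closed[OF star_closed[OF c(4,1)] c(3)]
        star_closed[OF c(4) star_closed[OF c(1,2)]] star_closed[OF c(4) star_closed[OF c(1,3)]]
      by algebra
    finally show ?thesis using c by (simp add: star_add_right)
  qed
  ultimately show ?thesis using gh by (simp add: adapted_def left_normed_add)
qed

lemma adapted_smult:
  assumes "adapted F h"
  shows "adapted F (c \<odot> h)"
proof -
  have h: "h \<in> left_normed" using assms by (simp add: adapted_def)
  have "\<exists>y. incl s x \<star> (c \<odot> h) = incl s y \<and> \<phi> y = starL (\<phi> x) (F (c \<odot> h))" for x
  proof -
    obtain y where "incl s x \<star> h = incl s y" "\<phi> y = starL (\<phi> x) (F h)"
      using assms unfolding adapted_def by blast
    then show ?thesis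
      using h by (intro exI[of _ "s c y"])
        (simp add: star_smult_right F_smult \<phi>.scale L.prod_simps incl_scale flip: T)
  qed
  moreover have "incl s x \<star> (k \<otimes> (c \<odot> h)) = (incl s x \<star> k) \<star> (c \<odot> h) \<ominus> incl s x \<star> (k \<star> (c \<odot> h))"
    if k: "k \<in> carrier T" for x k
  proof -
    have "c \<odot> (a \<ominus> b) = c \<odot> a \<ominus> c \<odot> b" if "a \<in> carrier T" "b \<in> carrier T" for a b
      using that by (intro additive_minus) (simp_all add: smult_r_distr)
    then show ?thesis
      using assms k h by (simp add: adapted_def smult_mult_right star_smult_right)
  qed
  ultimately show ?thesis using h by (simp add: adapted_def left_normed_smult)
qed

text \<open>Both sides are derivations of \<open>T(V)\<close> in \<open>u\<close>, so it suffices to compare them on \<open>V\<close>.\<close>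

lemma star_bracket:
  assumes g: "adapted F g" and u: "u \<in> carrier T"
  shows "u \<star> [g, incl s y]\<^sub>T =
    u \<star> g \<star> incl s y \<ominus> u \<star> incl s y \<star> g \<ominus> u \<star> (g \<star> incl s y) \<oplus> u \<star> (incl s y \<star> g)"
    (is "?L u = ?R u")
proof -
  let ?y = "incl s y"
  obtain z where z: "?y \<star> g = incl s z" using g unfolding adapted_def by blast
  have gl: "g \<in> left_normed" using g by (simp add: adapted_def)
  have c: "g \<in> carrier T" "?y \<in> carrier T" "g \<star> ?y \<in> carrier T" "?y \<star> g \<in> carrier T"
    using gl by simp_all
  \<comment> \<open>Primitivity of y * g rests on the first clause of \<open>adapted\<close>: this
    element is a letter z.\<close>
  have p: "primitive s g" "primitive s ?y" "primitive s (g \<star> ?y)" "primitive s (?y \<star> g)"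
    "primitive s [g, ?y]\<^sub>T"
    using gl left_normed_star_incl[OF gl] z
    by (simp_all add: left_normed_primitive left_normed_incl left_normed_bracket)
  \<comment> \<open>The term g y is handled by the axiom, the term y g by the second clause of
    \<open>adapted\<close> for g with k = y.\<close>
  have base: "?L (incl s x) = ?R (incl s x)" for x
  proof -
    have "?L (incl s x) = incl s x \<star> (g \<otimes> ?y) \<ominus> incl s x \<star> (?y \<otimes> g)"
      using c by (simp add: commutator_def star_minus_right)
    also have "\<dots> = (incl s x \<star> g \<star> ?y \<ominus> incl s x \<star> (g \<star> ?y)) \<ominus> (incl s x \<star> ?y \<star> g \<ominus> incl s x \<star> (?y \<star> g))"
      using c g by (simp add: adapted_def star_mult_incl)
    also have "\<dots> = ?R (incl s x)"
      using star_closed[OF star_closed[OF incl_carrier[of x] c(1)] c(2)]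
        star_closed[OF incl_carrier[of x] c(3)] star_closed[OF star_closed[OF incl_carrier[of x] c(2)] c(1)]
        star_closed[OF incl_carrier[of x] c(4)] by algebra
    finally show ?thesis .
  qed
  show ?thesis
    using u[unfolded T]
  proof (induction rule: tensor_algebra_induct)
    case zero
    then show ?case using c by (simp add: zero_star minus_eq flip: T)
  next
    case one
    then show ?case using c p by (simp add: zero_star one_star minus_eq flip: T)
  next
    case (incl x u)
    let ?x = "incl s x"
    have u: "u \<in> carrier T" and IH: "?L u = ?R u" using incl by (simp_all add: T)
    have x: "?x \<in> carrier T" by simp
    have L: "?L (?x \<otimes> u) = ?R ?x \<otimes> u \<oplus> ?x \<otimes> ?R u"
      using mult_star[OF p(5) x u] base[of x] IH by simp
    \<comment> \<open>Two derivations in a row leave the cross terms (x * g)(u * y) and (x * y)(u *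
      g). The same ones occur in \<open>R2\<close> and cancel in the difference: a commutator of
      derivations is a derivation.\<close>
    have R1: "(?x \<otimes> u) \<star> g \<star> ?y = (?x \<star> g \<star> ?y) \<otimes> u \<oplus> (?x \<star> g) \<otimes> (u \<star> ?y) \<oplus>
        ((?x \<star> ?y) \<otimes> (u \<star> g) \<oplus> ?x \<otimes> (u \<star> g \<star> ?y))"
      using x u c by (simp add: mult_star[OF p(1)] mult_star[OF p(2)] star_add_left)
    have R2: "(?x \<otimes> u) \<star> ?y \<star> g = (?x \<star> ?y \<star> g) \<otimes> u \<oplus> (?x \<star> ?y) \<otimes> (u \<star> g) \<oplus>
        ((?x \<star> g) \<otimes> (u \<star> ?y) \<oplus> ?x \<otimes> (u \<star> ?y \<star> g))"
      using x u c by (simp add: mult_star[OF p(1)] mult_star[OF p(2)] star_add_left)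
    have "(a \<ominus> b \<ominus> c \<oplus> d) \<otimes> u \<oplus> ?x \<otimes> (a' \<ominus> b' \<ominus> c' \<oplus> d') =
        (a \<otimes> u \<oplus> p \<oplus> (q \<oplus> ?x \<otimes> a')) \<ominus> (b \<otimes> u \<oplus> q \<oplus> (p \<oplus> ?x \<otimes> b')) \<ominus>
        (c \<otimes> u \<oplus> ?x \<otimes> c') \<oplus> (d \<otimes> u \<oplus> ?x \<otimes> d')"
      if "a \<in> carrier T" "b \<in> carrier T" "c \<in> carrier T" "d \<in> carrier T" "a' \<in> carrier T"
        "b' \<in> carrier T" "c' \<in> carrier T" "d' \<in> carrier T" "p \<in> carrier T" "q \<in> carrier T"
      for a b c d a' b' c' d' p q
      using that x u by algebra
    then have "?L (?x \<otimes> u) = ?R (?x \<otimes> u)"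
      unfolding L R1 R2 mult_star[OF p(3) x u] mult_star[OF p(4) x u]
      by this (use x u c in simp_all)
    then show ?case by (simp add: T)
  next
    case (add u v)
    then have u: "u \<in> carrier T" "v \<in> carrier T" and IH: "?L u = ?R u" "?L v = ?R v" by (simp_all add: T)
    have sum: "(a \<ominus> b \<ominus> c \<oplus> d) \<oplus> (a' \<ominus> b' \<ominus> c' \<oplus> d') =
        (a \<oplus> a') \<ominus> (b \<oplus> b') \<ominus> (c \<oplus> c') \<oplus> (d \<oplus> d')"
      if "a \<in> carrier T" "b \<in> carrier T" "c \<in> carrier T" "d \<in> carrier T" "a' \<in> carrier T"
        "b' \<in> carrier T" "c' \<in> carrier T" "d' \<in> carrier T" for a b c d a' b' c' d'
      using that by algebra
    have "?L (u \<oplus> v) = ?R u \<oplus> ?R v"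
      using u c IH by (simp add: star_add_left)
    also have "\<dots> = (u \<star> g \<star> ?y \<oplus> v \<star> g \<star> ?y) \<ominus> (u \<star> ?y \<star> g \<oplus> v \<star> ?y \<star> g) \<ominus>
        (u \<star> (g \<star> ?y) \<oplus> v \<star> (g \<star> ?y)) \<oplus> (u \<star> (?y \<star> g) \<oplus> v \<star> (?y \<star> g))"
      using u c by (intro sum) simp_all
    also have "\<dots> = ?R (u \<oplus> v)"
      using u c by (simp add: star_add_left)
    finally show ?case by (simp add: T)
  next
    case (smult d u)
    then have u: "u \<in> carrier T" and IH: "?L u = ?R u" by (simp_all add: T)
    have "d \<odot> (a \<ominus> b) = d \<odot> a \<ominus> d \<odot> b" if "a \<in> carrier T" "b \<in> carrier T" for a b
      using that by (intro additive_minus) (simp_all add: smult_r_distr)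
    then have "?L (d \<odot> u) = ?R (d \<odot> u)"
      using u c IH by (simp add: star_smult_left smult_r_distr)
    then show ?case by (simp add: T)
  qed
qed

text \<open>The first clause follows from \<open>star_bracket\<close> at u = x, compared with the
  post-Lie identity \<open>star_br\<close> in L. For the second, x * (k g y) and x * (k y g) are
  expanded separately.\<close>

lemma adapted_bracket:
  assumes g: "adapted F g" and gy: "adapted F (g \<star> incl s y)"
  shows "adapted F [g, incl s y]\<^sub>T"
proof -
  let ?y = "incl s y"
  have gl: "g \<in> left_normed" using g by (simp add: adapted_def)
  obtain z where z: "?y \<star> g = incl s z" "\<phi> z = starL (\<phi> y) (F g)"
    using g unfolding adapted_def by blast
  have c: "g \<in> carrier T" "?y \<in> carrier T" "g \<star> ?y \<in> carrier T" "?y \<star> g \<in> carrier T"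
    using gl by simp_all
  have Fgy: "F (g \<star> ?y) = starL (F g) (\<phi> y)"
    using star_adapted[OF adapted_incl gl, of y] by (simp add: F_incl)
  have "\<exists>w. incl s x \<star> [g, ?y]\<^sub>T = incl s w \<and> \<phi> w = starL (\<phi> x) (F [g, ?y]\<^sub>T)" for x
  proof -
    obtain a where a: "incl s x \<star> g = incl s a" "\<phi> a = starL (\<phi> x) (F g)"
      using g unfolding adapted_def by blast
    obtain b where b: "incl s (ast x y) \<star> g = incl s b" "\<phi> b = starL (\<phi> (ast x y)) (F g)"
      using g unfolding adapted_def by blast
    obtain d where d: "incl s x \<star> (g \<star> ?y) = incl s d" "\<phi> d = starL (\<phi> x) (F (g \<star> ?y))"
      using gy unfolding adapted_def by blast
    \<comment> \<open>The four terms of \<open>star_bracket\<close> are letters: a = x * g is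
      multiplied by y, b is (x * y) * g, d is x * (g * y), and x is multiplied by z = y * g. The
      letter d is where the hypothesis on g * y enters.\<close>
    have "incl s x \<star> [g, ?y]\<^sub>T = incl s (ast a y - b - d + ast x z)"
      using star_bracket[OF g incl_carrier, of x y]
      by (simp add: a b d z star_incl incl_minus incl_add flip: T)
    moreover have "\<phi> (ast a y - b - d + ast x z) = starL (\<phi> x) (F [g, ?y]\<^sub>T)"
      using gl by (simp add: \<phi>.add \<phi>.diff a b d z \<phi>_ast Fgy F_bracket F_incl left_normed_incl L.star_br)
    ultimately show ?thesis by blast
  qed
  moreover have "incl s x \<star> (k \<otimes> [g, ?y]\<^sub>T) = (incl s x \<star> k) \<star> [g, ?y]\<^sub>T \<ominus> incl s x \<star> (k \<star> [g, ?y]\<^sub>T)"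
    if k: "k \<in> carrier T" for x k
  proof -
    let ?x = "incl s x"
    have x: "?x \<in> carrier T" by simp
    \<comment> \<open>Needed below for k itself, for k * y and for the product k y, which is why
      \<open>adapted\<close> quantifies over all of T(V).\<close>
    have Ag: "?x \<star> (k \<otimes> g) = ?x \<star> k \<star> g \<ominus> ?x \<star> (k \<star> g)" if "k \<in> carrier T" for k
      using g that by (simp add: adapted_def)
    have Agy: "?x \<star> (k \<otimes> (g \<star> ?y)) = ?x \<star> k \<star> (g \<star> ?y) \<ominus> ?x \<star> (k \<star> (g \<star> ?y))"
      using gy k by (simp add: adapted_def)
    have Ayg: "?x \<star> (k \<otimes> (?y \<star> g)) = ?x \<star> k \<star> (?y \<star> g) \<ominus> ?x \<star> (k \<star> (?y \<star> g))"
      using k by (simp add: z star_mult_incl)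
    note p = left_normed_primitive[OF gl] primitive_incl[of s y]
    have "?x \<star> (k \<otimes> g \<otimes> ?y) = (?x \<star> k \<star> g \<ominus> ?x \<star> (k \<star> g)) \<star> ?y \<ominus>
        ?x \<star> ((k \<star> ?y) \<otimes> g \<oplus> k \<otimes> (g \<star> ?y))"
      using k c by (simp add: star_mult_incl Ag mult_star[OF p(2)])
    also have "\<dots> = (?x \<star> k \<star> g \<star> ?y \<ominus> ?x \<star> (k \<star> g) \<star> ?y) \<ominus>
        ((?x \<star> (k \<star> ?y) \<star> g \<ominus> ?x \<star> (k \<star> ?y \<star> g)) \<oplus> (?x \<star> k \<star> (g \<star> ?y) \<ominus> ?x \<star> (k \<star> (g \<star> ?y))))"
      using k c by (simp add: star_minus_left star_add_right Ag Agy)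
    finally have 1: "?x \<star> (k \<otimes> g \<otimes> ?y) = \<dots>" .
    have "?x \<star> (k \<otimes> ?y \<otimes> g) = (?x \<star> k \<star> ?y \<ominus> ?x \<star> (k \<star> ?y)) \<star> g \<ominus>
        ?x \<star> ((k \<star> g) \<otimes> ?y \<oplus> k \<otimes> (?y \<star> g))"
      using k c by (simp add: star_mult_incl Ag mult_star[OF p(1)])
    also have "\<dots> = (?x \<star> k \<star> ?y \<star> g \<ominus> ?x \<star> (k \<star> ?y) \<star> g) \<ominus>
        ((?x \<star> (k \<star> g) \<star> ?y \<ominus> ?x \<star> (k \<star> g \<star> ?y)) \<oplus> (?x \<star> k \<star> (?y \<star> g) \<ominus> ?x \<star> (k \<star> (?y \<star> g))))"
      using k c by (simp add: star_minus_left star_add_right star_mult_incl Ayg)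
    finally have 2: "?x \<star> (k \<otimes> ?y \<otimes> g) = \<dots>" .
    have 3: "?x \<star> (k \<star> [g, ?y]\<^sub>T) = ?x \<star> (k \<star> g \<star> ?y) \<ominus> ?x \<star> (k \<star> ?y \<star> g) \<ominus>
        ?x \<star> (k \<star> (g \<star> ?y)) \<oplus> ?x \<star> (k \<star> (?y \<star> g))"
      using k c by (simp add: star_bracket[OF g k] star_add_right star_minus_right)
    have "k \<otimes> [g, ?y]\<^sub>T = k \<otimes> g \<otimes> ?y \<ominus> k \<otimes> ?y \<otimes> g"
      unfolding commutator_def using k c(1,2) by algebra
    then have 4: "?x \<star> (k \<otimes> [g, ?y]\<^sub>T) = ?x \<star> (k \<otimes> g \<otimes> ?y) \<ominus> ?x \<star> (k \<otimes> ?y \<otimes> g)"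
      using k c by (simp add: star_minus_right)
    have xk: "?x \<star> k \<in> carrier T" using k by simp
    \<comment> \<open>The mixed terms b = (x * (k * g)) * y and c = (x * (k * y)) * g occur in both
      expansions and cancel. What remains is \<open>star_bracket\<close> at x * k minus expansion
      \<open>3\<close>.\<close>
    have "((a \<ominus> b) \<ominus> ((c \<ominus> d) \<oplus> (e \<ominus> f))) \<ominus> ((g \<ominus> c) \<ominus> ((b \<ominus> h) \<oplus> (i \<ominus> j))) =
        (a \<ominus> g \<ominus> e \<oplus> i) \<ominus> (h \<ominus> d \<ominus> f \<oplus> j)"
      if "a \<in> carrier T" "b \<in> carrier T" "c \<in> carrier T" "d \<in> carrier T" "e \<in> carrier T"
        "f \<in> carrier T" "g \<in> carrier T" "h \<in> carrier T" "i \<in> carrier T" "j \<in> carrier T"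
      for a b c d e f g h i j
      using that by algebra
    then show ?thesis
      unfolding 4 1 2 3 star_bracket[OF g xk] by this (use k c in simp_all)
  qed
  ultimately show ?thesis using gl by (simp add: adapted_def left_normed_bracket)
qed

text \<open>The induction is over all iterated products with elements of \<open>V\<close>, because the bracket step needs
  the claim for \<open>g * y\<close> as well as for \<open>g\<close>.\<close>

lemma left_normed_adapted:
  assumes "h \<in> left_normed"
  shows "adapted F h"
proof -
  let ?it = "\<lambda>h. foldl (\<lambda>h y. h \<star> incl s y) h"
  have it_closed: "?it h ys \<in> carrier T" if "h \<in> carrier T" for h ys
    using that by (induction ys arbitrary: h) simp_all
  have it_add: "?it (g \<oplus> h) ys = ?it g ys \<oplus> ?it h ys" if "g \<in> carrier T" "h \<in> carrier T" for g h ys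
    using that by (induction ys arbitrary: g h) (simp_all add: star_add_left)
  have it_smult: "?it (c \<odot> h) ys = c \<odot> ?it h ys" if "h \<in> carrier T" for c h ys
    using that by (induction ys arbitrary: h) (simp_all add: star_smult_left)
  have "adapted F (?it h ys)" for ys
    using assms
  proof (induction arbitrary: ys rule: left_normed.induct)
    case (left_normed_incl x)
    \<comment> \<open>An iterated product of letters is a letter.\<close>
    show ?case by (induction ys arbitrary: x) (simp_all add: adapted_incl star_incl)
  next
    case (left_normed_add f g)
    then show ?case by (simp add: it_add adapted_add)
  next
    case (left_normed_smult f c)
    then show ?case by (simp add: it_smult adapted_smult)
  next
    case (left_normed_bracket g y)
    then show ?case
    proof (induction ys arbitrary: g y)
      case Nil
      show ?case using adapted_bracket Nil.prems(2)[of "[]"] Nil.prems(2)[of "[y]"] by simp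
    next
      case (Cons z ys)
      \<comment> \<open>The derivation rule gives two brackets with a letter again, followed by a
        shorter list. Iterates of g * z are iterates of g along a list beginning with z, so the
        hypothesis on g covers them.\<close>
      have "[g, incl s y]\<^sub>T \<star> incl s z = [g \<star> incl s z, incl s y]\<^sub>T \<oplus> [g, incl s (ast y z)]\<^sub>T"
        using Cons.prems(1) by (simp add: bracket_star primitive_incl star_incl)
      moreover have "adapted F (?it [g \<star> incl s z, incl s y]\<^sub>T ys)"
        using Cons.IH[of "g \<star> incl s z" y] Cons.prems(2)[of "z # _"]
          left_normed_star_incl[OF Cons.prems(1)] by simp
      moreover have "adapted F (?it [g, incl s (ast y z)]\<^sub>T ys)"
        using Cons.IH Cons.prems by blast
      ultimately show ?case
        using Cons.prems(1) by (simp add: it_add adapted_add)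
    qed
  qed
  from this[of "[]"] show ?thesis by simp
qed

end

lemma post_lie_extension_exists:
  "\<exists>F. F \<in> extensional (carrier (free_lie s)) \<and>
    post_lie_morphism (free_lie s) (commutator T) (\<star>) scaleL br starL F \<and> (\<forall>x. F (incl s x) = \<phi> x)"
proof -
  obtain F where F:
    "\<And>X Y. X \<in> left_normed \<Longrightarrow> Y \<in> left_normed \<Longrightarrow> F (X \<oplus> Y) = F X + F Y"
    "\<And>c X. X \<in> left_normed \<Longrightarrow> F (c \<odot> X) = scaleL c (F X)"
    "\<And>X Y. X \<in> left_normed \<Longrightarrow> Y \<in> left_normed \<Longrightarrow> F [X, Y]\<^sub>T = br (F X) (F Y)"
    "\<And>x. F (incl s x) = \<phi> x"
    by (rule lie_extension_exists) blast
  have star: "f \<star> h \<in> left_normed \<and> F (f \<star> h) = starL (F f) (F h)"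
    if "f \<in> left_normed" "h \<in> left_normed" for f h
    using star_adapted[OF F] left_normed_adapted[OF F] that by blast
  have ops: "X \<oplus>\<^bsub>free_lie s\<^esub> Y = X \<oplus> Y" "c \<odot>\<^bsub>free_lie s\<^esub> X = c \<odot> X" for X Y c
    by (simp_all add: free_lie_def T)
  show ?thesis
    using F star
    \<comment> \<open>Restriction fixes the values off Lie(V), so that uniqueness can be an equality
      of functions.\<close>
    by (intro exI[of _ "restrict F left_normed"])
      (simp add: post_lie_morphism_def carrier_free_lie ops left_normed.intros bracket_left_normed)
qed

text \<open>Lie(V) is spanned by left-normed brackets of letters, so the values on V propagate
  through linearity and the bracket.\<close>

lemma post_lie_extension_unique:
  assumes F: "F \<in> extensional (carrier (free_lie s))"
      "post_lie_morphism (free_lie s) (commutator T) (\<star>) scaleL br starL F" "\<And>x. F (incl s x) = \<phi> x"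
    and G: "G \<in> extensional (carrier (free_lie s))"
      "post_lie_morphism (free_lie s) (commutator T) (\<star>) scaleL br starL G" "\<And>x. G (incl s x) = \<phi> x"
  shows "F = G"
proof (rule extensionalityI[OF F(1) G(1)])
  have ops: "X \<oplus>\<^bsub>free_lie s\<^esub> Y = X \<oplus> Y" "c \<odot>\<^bsub>free_lie s\<^esub> X = c \<odot> X" for X Y c
    by (simp_all add: free_lie_def T)
  fix h assume "h \<in> carrier (free_lie s)"
  then have "h \<in> left_normed" by (simp add: carrier_free_lie)
  then show "F h = G h"
    by (induction rule: left_normed.induct)
      (use F(2,3) G(2,3) in \<open>simp_all add: post_lie_morphism_def carrier_free_lie ops left_normed.intros\<close>)
qed

end

theorem theorem2:
  fixes scaleV :: "'k::field \<Rightarrow> 'v::ab_group_add \<Rightarrow> 'v"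
    and ast :: "'v \<Rightarrow> 'v \<Rightarrow> 'v"
    and scaleL :: "'k \<Rightarrow> 'l::ab_group_add \<Rightarrow> 'l"
    and br star :: "'l \<Rightarrow> 'l \<Rightarrow> 'l"
    and \<phi> :: "'v \<Rightarrow> 'l"
    and astT :: "('v list \<Rightarrow>\<^sub>0 'k) set \<Rightarrow> ('v list \<Rightarrow>\<^sub>0 'k) set \<Rightarrow> ('v list \<Rightarrow>\<^sub>0 'k) set"
  assumes "magmatic_algebra scaleV ast"
    and "extended_product scaleV ast astT"
    and "post_lie_algebra scaleL br star"
    and "magmatic_morphism scaleV ast scaleL star \<phi>"
  shows "\<exists>!F. F \<in> extensional (carrier (free_lie scaleV)) \<and>
    post_lie_morphism (free_lie scaleV) (commutator (tensor_algebra scaleV)) astT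
      scaleL br star F \<and>
    (\<forall>x. F (incl scaleV x) = \<phi> x)"
proof -
  interpret \<phi>: magmatic_morphism scaleV ast scaleL star \<phi> by (rule assms(4))
  interpret post_lie_target "tensor_algebra scaleV" scaleV ast astT scaleL br star \<phi>
    unfolding post_lie_target_def post_lie_target_axioms_def extended_product_tensor_def
      extended_product_tensor_axioms_def
    using k_algebra_tensor_algebra assms(2,3) \<phi>.linear_axioms \<phi>.map_prod by blast
  show ?thesis
    using post_lie_extension_exists post_lie_extension_unique by (metis (no_types, lifting))
qed

end
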